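(* Let $M\ge1$ be an integer and $(S^{(t)})_{t}$ positive integers. Consider the box–ball system with $M$ kinds of balls and carrier capacity $S^{(t)}$ at time $t$ (defined in the context), and fix a time $t$ at which the state has $N\ge1$ blocks of balls. For $k=1,\dots,M$ and $n=0,\dots,N-1$ let $Q^{(k,t)}_n$ be the number of balls with index $k$ in the $n$th block at time $t$, and for $n=0,\dots,N-2$ let $E^{(1,t)}_n$ be the number of empty boxes between the $n$th and $(n+1)$st blocks at time $t$; set $E^{(1,t)}_{N-1}:=+\infty$ and $Q^{(k,t)}_N:=0$. Define, for $n=0,\dots,N-1$, quantities $D^{(k)}_n$ ($k=1,\dots,M$), $\tilde E^{(k)}_n$ ($k=1,\dots,M+1$), $F_n$ and numbers $Q^{(k,t+1)}_n$, $E^{(1,t+1)}_n$ by the recursion \begin{gather*} D^{(k)}_0=Q^{(k,t)}_0,\quad F_0=E^{(1,t)}_0+\max\Big(0,S^{(t)}-\sum_{k=1}^MQ^{(k,t)}_0\Big),\quad \tilde E^{(1)}_0=E^{(1,t)}_0+\max\Big(0,\sum_{k=1}^MQ^{(k,t)}_0-S^{(t)}\Big),\\ Q^{(k,t+1)}_n=\min(D^{(k)}_n,\tilde E^{(k)}_n),\quad \tilde E^{(k+1)}_n=\tilde E^{(k)}_n-Q^{(k,t+1)}_n+Q^{(k,t)}_{n+1}\quad(k=1,\dots,M),\\ E^{(1,t+1)}_n=\min(F_n,\tilde E^{(M+1)}_n),\\ D^{(k)}_{n+1}=D^{(k)}_n-Q^{(k,t+1)}_n+Q^{(k,t)}_{n+1},\quad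 F_{n+1}=F_n-E^{(1,t+1)}_n+E^{(1,t)}_{n+1},\quad \tilde E^{(1)}_{n+1}=\tilde E^{(M+1)}_n-E^{(1,t+1)}_n+E^{(1,t)}_{n+1} \end{gather*} (the last line for $n\le N-2$). Then the state at time $t+1$ has $N$ blocks, and for $k=1,\dots,M$, $n=0,\dots,N-1$, the number of balls with index $k$ in its $n$th block equals $Q^{(k,t+1)}_n$, and for $n=0,\dots,N-2$ the number of empty boxes between its $n$th and $(n+1)$st blocks equals $E^{(1,t+1)}_n$. That is, $Q^{(k,t)}_n$ and $E^{(1,t)}_n$ satisfy the nonautonomous ultradiscrete hungry Toda lattice with the finite lattice condition $E^{(1,t)}_{N-1}=\tilde E^{(1)}_{N-1}=+\infty$.
   Context: Box–ball system: boxes are indexed by $n\in\mathbb Z$; each box contains either nothing or one ball with an index in $\{1,\dots,M\}$. Write $U^{(k,t)}_n\in\{0,1\}$ ($k=0,1,\dots,M$) for the number of balls of index $k$ in box $n$ at time $t$, where index $0$ means "empty space", so $\sum_{k=0}^MU^{(k,t)}_n=1$; only finitely many boxes are nonempty. Indices $k$ are taken modulo $M+1$. The state at time $t+1$ is obtained as follows: define $V^{(k,t)}_n$ (contents of the carrier at box $n$) by $V^{(0,t)}_n=S^{(t)}$, $V^{(k,t)}_n=0$ ($k=1,\dots,M$) for $n\ll0$, and \[ X^{(k,t)}_n=\min_{i=0,1,\dots,M}\Big(\sum_{j=0}^{M-i-1}U^{(k+j,t)}_n+\sum_{j=M-i+1}^{M}V^{(k+j,t)}_n\Big),\quad V^{(k,t)}_{n+1}=V^{(k,t)}_n+X^{(k,t)}_n-X^{(k+1,t)}_n,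 \] \[ U^{(k,t+1)}_n=U^{(k,t)}_n-X^{(k,t)}_n+X^{(k+1,t)}_n . \] Blocks: the nonempty boxes at a given time are partitioned into blocks, each being a maximal run of consecutive nonempty boxes whose ball indices are weakly increasing from left to right (e.g. the configuration 1222333112 consists of the two blocks 1222333 and 112). Blocks are numbered $0,1,\dots,N-1$ from left to right. Arithmetic with $+\infty$: $a+\infty=+\infty$, $\min(a,+\infty)=a$, $(+\infty)-a=+\infty$ for finite $a$. *)

theory Defs
  imports Main "HOL-Library.Extended_Nat"
begin

text \<open>A state is a function u :: int => nat giving the index of the ball in box n
  (0 = empty box), with u n <= M and finite support.\<close>

definition bbs_state :: "nat \<Rightarrow> (int \<Rightarrow> nat) \<Rightarrow> bool" where
  "bbs_state M u \<longleftrightarrow> (\<forall>n. u n \<le> M) \<and> finite {n. u n \<noteq> 0}"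

definition bbsU :: "nat \<Rightarrow> (int \<Rightarrow> nat) \<Rightarrow> int \<Rightarrow> int \<Rightarrow> int" where
  "bbsU M u n k = (if int (u n) = k mod (int M + 1) then 1 else 0)"

definition bbsX :: "nat \<Rightarrow> (int \<Rightarrow> int) \<Rightarrow> (int \<Rightarrow> int) \<Rightarrow> int \<Rightarrow> int" where
  "bbsX M U V k = Min ((\<lambda>i::nat. (\<Sum>j\<in>{0..int M - int i - 1}. U (k + j))
                                  + (\<Sum>j\<in>{int M - int i + 1..int M}. V (k + j))) ` {0..M})"

text \<open>Carrier contents V^(k) at box b + m, starting from the empty carrier
  (S empty slots) at box b.\<close>
fun bbs_carrier :: "nat \<Rightarrow> int \<Rightarrow> (int \<Rightarrow> nat) \<Rightarrow> int \<Rightarrow> nat \<Rightarrow> int \<Rightarrow> int" where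
  "bbs_carrier M S u b 0 = (\<lambda>k. if k mod (int M + 1) = 0 then S else 0)"
| "bbs_carrier M S u b (Suc m) =
     (let V = bbs_carrier M S u b m; U = bbsU M u (b + int m)
      in (\<lambda>k. V k + bbsX M U V k - bbsX M U V (k + 1)))"

definition bbs_base :: "(int \<Rightarrow> nat) \<Rightarrow> int" where
  "bbs_base u = (if {n. u n \<noteq> 0} = {} then 0 else Min {n. u n \<noteq> 0})"

definition bbs_newU :: "nat \<Rightarrow> int \<Rightarrow> (int \<Rightarrow> nat) \<Rightarrow> int \<Rightarrow> int \<Rightarrow> int" where
  "bbs_newU M S u n k =
     (let V = bbs_carrier M S u (bbs_base u) (nat (n - bbs_base u)); U = bbsU M u n
      in U k - bbsX M U V k + bbsX M U V (k + 1))"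

text \<open>Ball index in box n at time t+1 (the unique k in 1..M with U^(k,t+1)_n = 1,
  or 0 if the box is empty).\<close>
definition bbs_next :: "nat \<Rightarrow> int \<Rightarrow> (int \<Rightarrow> nat) \<Rightarrow> int \<Rightarrow> nat" where
  "bbs_next M S u n = nat (\<Sum>k\<in>{1..int M}. k * bbs_newU M S u n k)"

definition is_blocks :: "(int \<Rightarrow> nat) \<Rightarrow> (int \<times> int) list \<Rightarrow> bool" where
  "is_blocks u bs \<longleftrightarrow>
     (\<forall>i<length bs. fst (bs ! i) \<le> snd (bs ! i)) \<and>
     (\<forall>i. Suc i < length bs \<longrightarrow> snd (bs ! i) < fst (bs ! Suc i)) \<and>
     {n. u n \<noteq> 0} = (\<Union>i<length bs. {fst (bs ! i)..snd (bs ! i)}) \<and>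
     (\<forall>i<length bs. \<forall>n. fst (bs ! i) \<le> n \<and> n < snd (bs ! i) \<longrightarrow> u n \<le> u (n + 1)) \<and>
     (\<forall>i. Suc i < length bs \<and> snd (bs ! i) + 1 = fst (bs ! Suc i)
          \<longrightarrow> u (fst (bs ! Suc i)) < u (snd (bs ! i)))"

definition blkQ :: "(int \<Rightarrow> nat) \<Rightarrow> (int \<times> int) list \<Rightarrow> nat \<Rightarrow> nat \<Rightarrow> nat" where
  "blkQ u bs k n = (if n < length bs then card {j\<in>{fst (bs ! n)..snd (bs ! n)}. u j = k} else 0)"

definition blkE :: "(int \<times> int) list \<Rightarrow> nat \<Rightarrow> enat" where
  "blkE bs n = (if Suc n < length bs
                then enat (nat (fst (bs ! Suc n) - snd (bs ! n) - 1)) else \<infinity>)"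

text \<open>etil D e Qn j = tilde E^(j+1)_n, given D^(k)_n, tilde E^(1)_n = e and
  Qn k = Q^(k,t)_(n+1).  (All subtractions are exact: the subtrahend never exceeds
  the minuend.)\<close>
fun etil :: "(nat \<Rightarrow> enat) \<Rightarrow> enat \<Rightarrow> (nat \<Rightarrow> enat) \<Rightarrow> nat \<Rightarrow> enat" where
  "etil D e Qn 0 = e"
| "etil D e Qn (Suc j) = etil D e Qn j - min (D (Suc j)) (etil D e Qn j) + Qn (Suc j)"

fun hut_state :: "nat \<Rightarrow> int \<Rightarrow> (nat \<Rightarrow> nat \<Rightarrow> nat) \<Rightarrow> (nat \<Rightarrow> enat) \<Rightarrow> nat
                   \<Rightarrow> (nat \<Rightarrow> enat) \<times> enat \<times> enat" where
  "hut_state M S Q E 0 =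
     (let s = int (\<Sum>k\<in>{1..M}. Q k 0)
      in ((\<lambda>k. enat (Q k 0)),
          E 0 + enat (nat (max 0 (s - S))),
          E 0 + enat (nat (max 0 (S - s)))))"
| "hut_state M S Q E (Suc n) =
     (let (D, e, F) = hut_state M S Q E n;
          Qn1 = (\<lambda>k. enat (Q k (Suc n)));
          Et = etil D e Qn1;
          Q' = (\<lambda>k. min (D k) (Et (k - 1)));
          E' = min F (Et M)
      in ((\<lambda>k. D k - Q' k + Qn1 k), Et M - E' + E (Suc n), F - E' + E (Suc n)))"

definition hut_Q :: "nat \<Rightarrow> int \<Rightarrow> (nat \<Rightarrow> nat \<Rightarrow> nat) \<Rightarrow> (nat \<Rightarrow> enat) \<Rightarrow> nat \<Rightarrow> nat \<Rightarrow> enat" where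
  "hut_Q M S Q E k n =
     (case hut_state M S Q E n of (D, e, F) \<Rightarrow>
        min (D k) (etil D e (\<lambda>k. enat (Q k (Suc n))) (k - 1)))"

definition hut_E :: "nat \<Rightarrow> int \<Rightarrow> (nat \<Rightarrow> nat \<Rightarrow> nat) \<Rightarrow> (nat \<Rightarrow> enat) \<Rightarrow> nat \<Rightarrow> enat" where
  "hut_E M S Q E n =
     (case hut_state M S Q E n of (D, e, F) \<Rightarrow>
        min F (etil D e (\<lambda>k. enat (Q k (Suc n))) M))"

end

(*
  Number the runs of equal boxes by generations: the balls of index k in block n form generation
  (M + 1) (n + 1) + k, and the gap behind block n forms generation (M + 1) (n + 2), so that the
  content of a box is its generation modulo M + 1. The carrier swaps a box of colour a for the first
  colour it contains in the cyclic order a + 1, a + 2, ..., a + M. Since generations are read in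
  increasing order, it acts as a first-in-first-out queue with one exception: an item still in the carrier
  when the generation M + 1 later is read becomes indistinguishable from, and is promoted to, that
  generation. Hence the length of generation g at time t + 1 is the minimum of its stock D g and of
  the room R g up to the end of input generation g + M, and these two numbers obey the
  recursion of the Toda lattice. Being the block decomposition of a state means that no M
  consecutive generations are empty, a property that the recursion preserves.
*)
theory Submission
  imports Defs
begin

section \<open>The recursion on generations\<close>

text \<open>Empty slots count as items of colour 0, which makes the rule cyclic in the colours.
  While generation \<open>a\<close> is read, the colours \<open>a + 1\<close>, ...,
  \<open>a + M\<close> in the carrier are those of the generations \<open>a - M\<close>, ...,
  \<open>a - 1\<close>, in this order, so the first colour present is the oldest generation present;
  this is why a rule about colours acts as a queue. Since the rule does not see generations, one has
  to know that the generation \<open>c\<close> put into a box that held generation \<open>a\<close>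
  satisfies \<open>c <= a < c + m\<close>: then the colour of \<open>c\<close> determines
  \<open>c\<close>. The upper bound is built into the room \<open>R\<close>. The lower bound says
  that the output never gets ahead of the input, and it rests on the conservation of the
  \<open>S\<close> carrier slots. That blocks neither vanish nor merge is a separate matter: two
  blocks may touch with an empty gap between them, and only a strict descent of the colours
  separates them there. The condition on windows of \<open>M\<close> generations covers both cases
  at once.\<close>

definition clip :: "int \<Rightarrow> (nat \<Rightarrow> int) \<Rightarrow> nat \<Rightarrow> int" where
  "clip p F g = min p (F (Suc g)) - min p (F g)"

text \<open>If generation \<open>g\<close> occupies the boxes from \<open>F g\<close> up to but
  excluding \<open>F (Suc g)\<close>, then \<open>clip p F g\<close> is the number of its boxes
  among the first \<open>p\<close>. Passing box \<open>p\<close> affects only the generation that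
  contains it.\<close>

lemma clip_Suc:
  assumes "\<And>g h. g \<le> h \<Longrightarrow> F g \<le> F h" "F a \<le> p" "p < F (Suc a)"
  shows "clip (p + 1) F g = clip p F g + (if g = a then 1 else 0)"
proof -
  consider "g < a" | "g = a" | "a < g" by linarith
  then show ?thesis
  proof cases
    case 1
    then have "F (Suc g) \<le> F a" "F g \<le> F a" by (auto intro: assms(1))
    then show ?thesis using 1 assms(2) by (simp add: clip_def)
  next
    case 2
    then show ?thesis using assms(2,3) by (simp add: clip_def)
  next
    case 3
    then have "F (Suc a) \<le> F g" "F (Suc a) \<le> F (Suc g)" by (auto intro: assms(1))
    then show ?thesis using 3 assms(3) by (simp add: clip_def)
  qed
qed

locale generations =
  fixes M :: nat and S :: int and L :: "nat \<Rightarrow> int"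
  assumes S_nonneg: "0 \<le> S"
    and L_nonneg: "0 \<le> L g"
    and L_zero: "g \<le> Suc M \<Longrightarrow> L g = 0"
begin

abbreviation m :: nat where "m \<equiv> Suc M"

text \<open>\<open>L g\<close> is the length of generation \<open>g\<close> at time \<open>t\<close>, and \<open>Out g\<close> below its length at time \<open>t + 1\<close>.
  \<open>D g\<close> counts the items of generation \<open>g\<close>, including those promoted from generation \<open>g - m\<close>,
  and \<open>R g\<close> counts the boxes available to them, namely those from the end of output
  generation \<open>g - 1\<close> to the end of input generation \<open>g + M\<close>. The \<open>S\<close> empty slots of
  the initial carrier are the stock of generation \<open>m\<close>.\<close>
fun D :: "nat \<Rightarrow> int" and R :: "nat \<Rightarrow> int" where
  "D g = L g + (if g = m then S else 0)
         + (if m \<le> g then D (g - m) - min (D (g - m)) (R (g - m)) else 0)"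
| "R 0 = 0"
| "R (Suc g) = R g - min (D g) (R g) + L (g + m)"

declare D.simps [simp del] R.simps [simp del]

definition Out :: "nat \<Rightarrow> int" where "Out g = min (D g) (R g)"
definition Lam :: "nat \<Rightarrow> int" where "Lam g = (\<Sum>h<g. L h)"
definition Om :: "nat \<Rightarrow> int" where "Om g = (\<Sum>h<g. Out h)"

lemma D_rec: "D g = L g + (if g = m then S else 0) + (if m \<le> g then D (g - m) - Out (g - m) else 0)"
  unfolding Out_def by (rule D.simps)

lemma R_Suc: "R (Suc g) = R g - Out g + L (g + m)"
  unfolding Out_def by (rule R.simps)

lemma Lam_Suc: "Lam (Suc g) = Lam g + L g"
  by (simp add: Lam_def)

lemma Om_Suc: "Om (Suc g) = Om g + Out g"
  by (simp add: Om_def)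

lemma Out_le_D: "Out g \<le> D g" and Out_le_R: "Out g \<le> R g"
  by (simp_all add: Out_def)

lemma L_le_D: "L g \<le> D g"
  using S_nonneg Out_le_D[of "g - m"] by (subst D_rec) auto

lemma D_nonneg: "0 \<le> D g"
  using L_nonneg L_le_D order_trans by blast

lemma D_early: "g < m \<Longrightarrow> D g = 0"
  by (subst D_rec) (simp add: L_zero)

lemma L_le_R: "L (g + M) \<le> R g"
proof (cases g)
  case 0
  then show ?thesis by (simp add: R.simps L_zero)
next
  case (Suc h)
  then show ?thesis using Out_le_R[of h] by (simp add: R_Suc)
qed

lemma R_nonneg: "0 \<le> R g"
  using L_nonneg L_le_R order_trans by blast

lemma Out_nonneg: "0 \<le> Out g"
  by (simp add: Out_def D_nonneg R_nonneg)

lemma Out_early: "g < m \<Longrightarrow> Out g = 0"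
  using Out_le_D[of g] Out_nonneg[of g] by (simp add: D_early)

lemma Lam_mono: "g \<le> h \<Longrightarrow> Lam g \<le> Lam h"
  unfolding Lam_def by (rule sum_mono2) (auto simp: L_nonneg)

lemma Om_mono: "g \<le> h \<Longrightarrow> Om g \<le> Om h"
  unfolding Om_def by (rule sum_mono2) (auto simp: Out_nonneg)

lemma Lam_early: "g \<le> Suc m \<Longrightarrow> Lam g = 0"
  unfolding Lam_def by (rule sum.neutral) (auto simp: L_zero)

lemma Om_nonneg: "0 \<le> Om g"
  unfolding Om_def by (simp add: sum_nonneg Out_nonneg)

lemma Lam_nonneg: "0 \<le> Lam g"
  unfolding Lam_def by (simp add: sum_nonneg L_nonneg)

lemma R_eq: "R g = Lam (g + m) - Om g"
proof (induction g)
  case 0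
  then show ?case using Lam_early[of m] by (simp add: R.simps Om_def)
next
  case (Suc g)
  then show ?case using Lam_Suc[of "g + m"] by (simp add: R_Suc Om_Suc)
qed

text \<open>This is promotion as an inequality between positions; it yields \<open>a < c + m\<close>
  for the input generation \<open>a\<close> and the output generation \<open>c\<close> of a
  box.\<close>

lemma Om_Suc_le: "Om (Suc g) \<le> Lam (g + m)"
  using Out_le_R[of g] by (simp add: R_eq Om_Suc)

text \<open>Conservation of the number \<open>S\<close> of carrier slots.\<close>
lemma sum_D: "(\<Sum>g\<in>{Suc h..<Suc h + m}. D g) = R (Suc h) + S"
proof -
  have step: "(\<Sum>g\<in>{Suc h..<Suc h + m}. D g) = (\<Sum>g\<in>{h..<h + m}. D g) + D (h + m) - D h" for h
  proof -
    have "(\<Sum>g\<in>{h..<Suc h + m}. D g) = D h + (\<Sum>g\<in>{Suc h..<Suc h + m}. D g)"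
      by (rule sum.atLeast_Suc_lessThan) simp
    moreover have "(\<Sum>g\<in>{h..<Suc (h + m)}. D g) = (\<Sum>g\<in>{h..<h + m}. D g) + D (h + m)"
      by (rule sum.atLeastLessThan_Suc) simp
    ultimately show ?thesis by simp
  qed
  have DL: "D (h + m) - D h = L (h + m) - Out h + (if h = 0 then S else 0)" for h
    by (subst D_rec) auto
  show ?thesis
  proof (induction h)
    case 0
    have "(\<Sum>g\<in>{0..<0 + m}. D g) = 0"
      by (rule sum.neutral) (auto simp: D_early)
    moreover have "R 0 = 0" by (simp add: R.simps)
    ultimately show ?case
      using step[of 0] DL[of 0] R_Suc[of 0] by simp
  next
    case (Suc h)
    then show ?case
      using step[of "Suc h"] DL[of "Suc h"] R_Suc[of "Suc h"] by auto
  qed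
qed

text \<open>A generation whose output ends strictly before generation \<open>x + m\<close> begins
  has room left, so it stops because its stock is exhausted.\<close>

lemma Out_eq_D:
  assumes "Om (Suc x) < Lam (x + m)"
  shows "Out x = D x"
  using assms by (simp add: Om_Suc Out_def R_eq min_def split: if_splits)

text \<open>If the output fell short, each of the \<open>m\<close> generations below
  \<open>g\<close> would be emitted in full. By \<open>sum_D\<close> their stocks would then fill
  the boxes up to \<open>Lam g + S\<close>, which is a contradiction. The lemma yields
  \<open>c <= a\<close> for the generations of a box.\<close>

lemma Lam_le_Om: "Lam g \<le> Om g"
proof (cases "g \<le> Suc m")
  case True
  then show ?thesis by (simp add: Lam_early Om_nonneg)
next
  case False
  then have g: "g = Suc (g - Suc m) + m" by simp
  define h where "h = g - Suc m"
  note g = g[folded h_def]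
  show ?thesis
  proof (rule ccontr)
    assume "\<not> ?thesis"
    then have less: "Om g < Lam g" by simp
    have "Out x = D x" if "x \<in> {Suc h..<g}" for x
    proof (rule Out_eq_D)
      have "Om (Suc x) \<le> Om g" "Lam g \<le> Lam (x + m)"
        using that g by (auto intro!: Om_mono Lam_mono)
      then show "Om (Suc x) < Lam (x + m)" using less by linarith
    qed
    then have "(\<Sum>x\<in>{Suc h..<g}. Out x) = (\<Sum>x\<in>{Suc h..<g}. D x)" by (rule sum.cong[OF refl])
    also have "\<dots> = Lam g - Om (Suc h) + S" using sum_D[of h] by (simp add: g R_eq)
    finally have "(\<Sum>x\<in>{Suc h..<g}. Out x) = Lam g - Om (Suc h) + S" .
    moreover have "Om g = Om (Suc h) + (\<Sum>x\<in>{Suc h..<g}. Out x)"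
      unfolding Om_def using g sum.atLeastLessThan_concat[of 0 "Suc h" g Out]
      by (simp add: lessThan_atLeast0)
    ultimately show False using less S_nonneg by linarith
  qed
qed

text \<open>If \<open>Out\<close> vanishes on a window of length \<open>M\<close>, then \<open>R\<close> is increasing there. Where \<open>R\<close>
  vanishes, \<open>L\<close> vanishes \<open>M\<close> places later; where it does not, \<open>L\<close> itself vanishes. The two
  parts add up to a window of length \<open>M\<close> on which \<open>L\<close> vanishes.\<close>
lemma window_Out:
  assumes window_L: "\<And>h. m \<le> h \<Longrightarrow> h + M < G \<Longrightarrow> \<exists>g\<in>{Suc h..h + M}. 0 < L g"
    and "0 < L G" "m \<le> h" "h + M < G"
  shows "\<exists>g\<in>{Suc h..h + M}. 0 < Out g"
proof (rule ccontr)
  assume "\<not> ?thesis"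
  then have zero: "Out g = 0" if "g \<in> {Suc h..h + M}" for g
    using that Out_nonneg[of g] by force
  define j where "j = (LEAST j. Suc h \<le> j \<and> (j = Suc (h + M) \<or> 0 < R j))"
  have "Suc h \<le> Suc (h + M) \<and> (Suc (h + M) = Suc (h + M) \<or> 0 < R (Suc (h + M)))" by simp
  then have j: "Suc h \<le> j" "j = Suc (h + M) \<or> 0 < R j" and j_le: "j \<le> Suc (h + M)"
    unfolding j_def
    by (metis (mono_tags, lifting) LeastI, metis (mono_tags, lifting) LeastI,
        metis (mono_tags, lifting) Least_le)
  have left: "L (g + M) = 0" if "Suc h \<le> g" "g < j" for g
  proof -
    have "\<not> 0 < R g" using that not_less_Least[of g] unfolding j_def by blast
    then show ?thesis using L_le_R[of g] L_nonneg[of "g + M"] by linarith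
  qed
  have right: "L g = 0" if "j \<le> g" "g \<le> h + M" for g
  proof -
    have Rpos: "0 < R g" using that(1,2)
    proof (induction g rule: dec_induct)
      case base
      then show ?case using j by auto
    next
      case (step n)
      then show ?case
        using zero[of n] j L_nonneg[of "n + m"] by (simp add: R_Suc)
    qed
    have "Out g = 0" using that j by (intro zero) auto
    then have "D g = 0" using Rpos by (simp add: Out_def min_def split: if_splits)
    then show ?thesis using L_le_D[of g] L_nonneg[of g] by linarith
  qed
  have all: "L g = 0" if "j \<le> g" "g < j + M" for g
  proof (cases "g \<le> h + M")
    case True then show ?thesis using right that by blast
  next
    case False then show ?thesis using left[of "g - M"] that by auto
  qed
  show False
  proof (cases "j + M \<le> G")
    case True
    have "m \<le> j - 1" "j - 1 + M < G" using True j(1) assms(3) by linarith+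
    then obtain g where g: "g \<in> {Suc (j - 1)..j - 1 + M}" "0 < L g"
      using window_L by blast
    then have "j \<le> g" "g < j + M" using j(1) by auto
    then show False using all[of g] g by auto
  next
    case False
    then show False using all[of G] assms(2,4) j_le by auto
  qed
qed

text \<open>The number of items of the colour of \<open>g\<close> in the carrier at position \<open>p\<close>, if only
  generations up to \<open>g\<close> are taken into account.\<close>
function W :: "int \<Rightarrow> nat \<Rightarrow> int" where
  "W p g = (if m \<le> g then W p (g - m) else 0) + (if g = m then S else 0) + clip p Lam g - clip p Om g"
  by auto
termination by (relation "measure snd") auto

declare W.simps [simp del]

lemma W_0: "W 0 g = (if g mod m = 0 \<and> m \<le> g then S else 0)"
proof (induction g rule: less_induct)
  case (less g)
  have c: "clip 0 Lam g = 0" "clip 0 Om g = 0"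
    by (simp_all add: clip_def Lam_nonneg Om_nonneg)
  show ?case
  proof (cases "m \<le> g")
    case True
    show ?thesis
    proof (cases "g = m")
      case True
      then show ?thesis using less.IH[of 0] c by (subst W.simps) simp
    next
      case False
      have "g mod m = 0 \<Longrightarrow> m \<le> g - m"
      proof -
        assume "g mod m = 0"
        then have "m dvd g - m" using True by (auto simp: le_mod_geq)
        then show "m \<le> g - m" using True False by (intro dvd_imp_le) auto
      qed
      then show ?thesis using True False less.IH[of "g - m"]
        by (subst W.simps) (auto simp: c le_mod_geq)
    qed
  next
    case False
    then show ?thesis by (subst W.simps) (simp add: c)
  qed
qed

lemma W_Suc:
  assumes "Lam a \<le> p" "p < Lam (Suc a)" "Om c \<le> p" "p < Om (Suc c)"
  shows "W (p + 1) g = W p g + (if g mod m = a mod m \<and> a \<le> g then 1 else 0)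
           - (if g mod m = c mod m \<and> c \<le> g then 1 else 0)"
proof (induction g rule: less_induct)
  case (less g)
  have c1: "clip (p + 1) Lam g = clip p Lam g + (if g = a then 1 else 0)"
    by (rule clip_Suc) (use Lam_mono assms in auto)
  have c2: "clip (p + 1) Om g = clip p Om g + (if g = c then 1 else 0)"
    by (rule clip_Suc) (use Om_mono assms in auto)
  have aux: "(g mod m = x mod m \<and> x \<le> g) = ((m \<le> g \<and> (g - m) mod m = x mod m \<and> x \<le> g - m) \<or> g = x)" for x
  proof
    assume A: "g mod m = x mod m \<and> x \<le> g"
    show "(m \<le> g \<and> (g - m) mod m = x mod m \<and> x \<le> g - m) \<or> g = x"
    proof (cases "g = x")
      case False
      have "m dvd g - x" using A by (metis mod_eq_dvd_iff_nat)
      then have "m \<le> g - x" using A False by (intro dvd_imp_le) auto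
      then show ?thesis using A by (auto simp: le_mod_geq)
    qed simp
  next
    assume "(m \<le> g \<and> (g - m) mod m = x mod m \<and> x \<le> g - m) \<or> g = x"
    then show "g mod m = x mod m \<and> x \<le> g" by (auto simp: le_mod_geq)
  qed
  define I :: "nat \<Rightarrow> nat \<Rightarrow> int" where "I x g = (if g mod m = x mod m \<and> x \<le> g then 1 else 0)" for x g
  have I: "I x g = (if m \<le> g then I x (g - m) else 0) + (if g = x then 1 else 0)" for x
    unfolding I_def using aux[of x] by auto
  have IH: "W (p + 1) (g - m) = W p (g - m) + I a (g - m) - I c (g - m)" if "m \<le> g"
    unfolding I_def using that by (intro less.IH) auto
  have "W (p + 1) g = W p g + I a g - I c g"
  proof (cases "m \<le> g")
    case True
    show ?thesis
      unfolding I[of a] I[of c] W.simps[of "p + 1" g] W.simps[of p g] c1 c2 if_P[OF True] IH[OF True]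
      by linarith
  next
    case False
    show ?thesis
      unfolding I[of a] I[of c] W.simps[of "p + 1" g] W.simps[of p g] c1 c2 if_not_P[OF False]
      by linarith
  qed
  then show ?case by (simp only: I_def)
qed

text \<open>Once generation \<open>x\<close> has been read, its stock is complete: generation
  \<open>x - m\<close> has finished its output by then, and its remainder has been promoted.\<close>

lemma W_below:
  assumes "Lam (Suc x) \<le> p"
  shows "W p x = D x - clip p Om x"
  using assms
proof (induction x rule: less_induct)
  case (less x)
  have cl: "clip p Lam x = L x"
    using less.prems Lam_Suc[of x] L_nonneg[of x] by (simp add: clip_def)
  show ?case
  proof (cases "m \<le> x")
    case True
    have "Lam (Suc (x - m)) \<le> Lam (Suc x)" by (intro Lam_mono) simp
    then have "W p (x - m) = D (x - m) - clip p Om (x - m)"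
      using True less by auto
    moreover have "clip p Om (x - m) = Out (x - m)"
    proof -
      have "Om (Suc (x - m)) \<le> Lam x" using Om_Suc_le[of "x - m"] True by simp
      then have "Om (Suc (x - m)) \<le> p" using less.prems Lam_mono[of x "Suc x"] by simp
      then show ?thesis using Om_Suc[of "x - m"] Out_nonneg[of "x - m"] by (simp add: clip_def)
    qed
    ultimately show ?thesis using True cl by (subst W.simps, subst D_rec) auto
  next
    case False
    then show ?thesis using cl by (subst W.simps, subst D_rec) auto
  qed
qed

end

section \<open>The carrier\<close>

lemma ex_step_containing:
  fixes F :: "nat \<Rightarrow> int"
  assumes F0: "F 0 \<le> p" and ex: "\<exists>g. p < F g"
  obtains a where "F a \<le> p" "p < F (Suc a)"
proof -
  define g where "g = (LEAST g. p < F g)"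
  have g: "p < F g" unfolding g_def using ex by (rule LeastI_ex)
  then obtain a where a: "g = Suc a" using F0 by (cases g) auto
  have "\<not> p < F a" using not_less_Least[of a "\<lambda>g. p < F g"] a unfolding g_def by simp
  then show ?thesis using that[of a] g a by auto
qed

lemma bbsX_cong_mod:
  assumes U: "\<And>i j. i mod (int M + 1) = j mod (int M + 1) \<Longrightarrow> U i = U j"
    and V: "\<And>i j. i mod (int M + 1) = j mod (int M + 1) \<Longrightarrow> V i = V j"
    and "k mod (int M + 1) = l mod (int M + 1)"
  shows "bbsX M U V k = bbsX M U V l"
proof -
  have *: "(k + j) mod (int M + 1) = (l + j) mod (int M + 1)" for j
    using assms(3) by (metis mod_add_left_eq)
  have "U (k + j) = U (l + j)" "V (k + j) = V (l + j)" for j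
    using U[OF *] V[OF *] by blast+
  then show ?thesis unfolding bbsX_def by simp
qed

lemma mod_eq_less_imp_eq:
  fixes x y c :: int
  assumes "x mod c = y mod c" "\<bar>x - y\<bar> < c"
  shows "x = y"
proof -
  have "c dvd x - y" using assms(1) by (simp add: mod_eq_dvd_iff)
  then show ?thesis using assms(2) zdvd_imp_le[of c "x - y"] zdvd_imp_le[of c "y - x"]
    by (cases "x - y" "0::int" rule: linorder_cases) (auto simp: dvd_diff_commute)
qed

text \<open>The carrier swaps the box content \<open>a\<close> for the first colour it contains among
  \<open>a + 1\<close>, \<dots>, \<open>a + M\<close>, which is \<open>a + d\<close>; if there is none, the box keeps its content.\<close>
lemma bbsX_value:
  fixes a d c :: int
  assumes U: "\<And>k. U k = (if k mod (int M + 1) = a mod (int M + 1) then 1 else 0)"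
    and V_mod: "\<And>i j. i mod (int M + 1) = j mod (int M + 1) \<Longrightarrow> V i = V j"
    and V_nonneg: "\<And>k. 0 \<le> V k"
    and V_zero: "\<And>j. 1 \<le> j \<Longrightarrow> j < d \<Longrightarrow> V (a + j) = 0"
    and V_pos: "d = int M + 1 \<or> 0 < V (a + d)"
    and d: "1 \<le> d" "d \<le> int M + 1"
    and c: "1 \<le> c" "c \<le> int M + 1"
  shows "bbsX M U V (a + c) = (if d < c then 1 else 0)"
proof -
  define f where "f i = (\<Sum>j\<in>{0..int M - int i - 1}. U (a + c + j))
      + (\<Sum>j\<in>{int M - int i + 1..int M}. V (a + c + j))" for i :: nat
  have X: "bbsX M U V (a + c) = Min (f ` {0..M})"
    unfolding bbsX_def f_def by simp
  \<comment> \<open>Offset at which a window of colours starting at \<open>a + c\<close> meets the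
    colour \<open>a\<close> of the box.\<close>
  define e where "e = int M + 1 - c"
  have U_e: "U (a + c + j) = (if j = e then 1 else 0)" if "0 \<le> j" "j \<le> int M" for j
  proof (cases "j = e")
    case True
    then show ?thesis by (simp add: U e_def)
  next
    case False
    have "(a + c + j) mod (int M + 1) \<noteq> a mod (int M + 1)"
    proof
      assume "(a + c + j) mod (int M + 1) = a mod (int M + 1)"
      then have "(a + c + j) mod (int M + 1) = (a + int M + 1) mod (int M + 1)"
        by (metis add.assoc mod_add_self2)
      then have "a + c + j = a + int M + 1"
        by (rule mod_eq_less_imp_eq) (use that c in auto)
      then show False using False by (simp add: e_def)
    qed
    then show ?thesis using False by (simp add: U)
  qed
  have V_e: "V (a + c + j) = V (a + (j - e))" for j
  proof (rule V_mod)
    have "a + c + j = a + (j - e) + (int M + 1)" by (simp add: e_def)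
    then show "(a + c + j) mod (int M + 1) = (a + (j - e)) mod (int M + 1)"
      by (metis mod_add_self2)
  qed
  have sumU: "(\<Sum>j\<in>{0..int M - int i - 1}. U (a + c + j)) = (if e \<le> int M - int i - 1 then 1 else 0)" for i
  proof -
    have "(\<Sum>j\<in>{0..int M - int i - 1}. U (a + c + j)) = (\<Sum>j\<in>{0..int M - int i - 1}. if j = e then 1 else 0)"
      by (rule sum.cong) (auto simp: U_e)
    also have "\<dots> = (if e \<le> int M - int i - 1 then 1 else 0)"
      using c by (simp add: e_def)
    finally show ?thesis .
  qed
  have sumV_nonneg: "0 \<le> (\<Sum>j\<in>J. V (a + c + j))" for J
    by (intro sum_nonneg V_nonneg)
  show ?thesis
  proof (cases "d < c")
    case True
    have "1 \<le> f i" if "i \<in> {0..M}" for i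
    proof (cases "e \<le> int M - int i - 1")
      case True
      then show ?thesis using sumV_nonneg by (simp add: f_def sumU)
    next
      case False
      \<comment> \<open>A \<open>U\<close> window that stops before offset \<open>e\<close> leaves a
        \<open>V\<close> window starting at \<open>e + 1\<close> or earlier; it therefore reaches
        offset \<open>d + e\<close>, the colour \<open>a + d\<close>.\<close>
      have mem: "d + e \<in> {int M - int i + 1..int M}"
        using False d \<open>d < c\<close> by (auto simp: e_def)
      have "V (a + c + (d + e)) \<le> (\<Sum>j\<in>{int M - int i + 1..int M}. V (a + c + j))"
        using mem by (intro member_le_sum V_nonneg) auto
      moreover have "V (a + c + (d + e)) \<ge> 1"
        using V_e[of "d + e"] V_pos \<open>d < c\<close> c by auto
      ultimately show ?thesis using False by (simp add: f_def sumU)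
    qed
    moreover have "f 0 \<le> 1" using sumU[of 0] by (simp add: f_def)
    ultimately have "f 0 = 1" "\<And>y. y \<in> f ` {0..M} \<Longrightarrow> 1 \<le> y" by force+
    then have "Min (f ` {0..M}) = 1" by (intro Min_eqI) force+
    then show ?thesis using True X by simp
  next
    case False
    \<comment> \<open>For this \<open>i\<close> the \<open>U\<close> window ends at
      \<open>e - 1\<close> and the \<open>V\<close> window begins at \<open>e + 1\<close>, so that
      it consists of the colours \<open>a + 1\<close>, ..., \<open>a + c - 1\<close>, all absent
      from the carrier.\<close>
    define i where "i = nat (c - 1)"
    have i: "i \<in> {0..M}" "int i = c - 1" using c by (auto simp: i_def)
    have "f i = (\<Sum>j\<in>{int M - int i + 1..int M}. V (a + c + j))"
      unfolding f_def sumU using i by (simp add: e_def)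
    also have "\<dots> = 0"
    proof (rule sum.neutral, rule ballI)
      fix j assume "j \<in> {int M - int i + 1..int M}"
      then have "1 \<le> j - e" "j - e < d" using i False c by (auto simp: e_def)
      then show "V (a + c + j) = 0" using V_zero V_e by simp
    qed
    finally have "f i = 0" .
    moreover have "0 \<le> f i'" for i' using sumV_nonneg by (simp add: f_def sumU)
    ultimately have "Min (f ` {0..M}) = 0" using i by (intro Min_eqI) force+
    then show ?thesis using False X by simp
  qed
qed

text \<open>Along the colours \<open>a + 1\<close>, ..., \<open>a + M + 1\<close> the value of
  \<open>bbsX\<close> jumps from 0 to 1 after \<open>a + d\<close> and drops back to 0 after
  \<open>a + M + 1\<close>, which is colour \<open>a\<close> again. The two jumps are the item given
  away and the item received by the carrier; for \<open>d = M + 1\<close> they cancel.\<close>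

lemma bbsX_diff:
  fixes a d :: int
  assumes U: "\<And>k. U k = (if k mod (int M + 1) = a mod (int M + 1) then 1 else 0)"
    and V_mod: "\<And>i j. i mod (int M + 1) = j mod (int M + 1) \<Longrightarrow> V i = V j"
    and V_nonneg: "\<And>k. 0 \<le> V k"
    and V_zero: "\<And>j. 1 \<le> j \<Longrightarrow> j < d \<Longrightarrow> V (a + j) = 0"
    and V_pos: "d = int M + 1 \<or> 0 < V (a + d)"
    and d: "1 \<le> d" "d \<le> int M + 1"
  shows "bbsX M U V k - bbsX M U V (k + 1)
         = (if k mod (int M + 1) = a mod (int M + 1) then 1 else 0)
           - (if k mod (int M + 1) = (a + d) mod (int M + 1) then 1 else 0)"
proof -
  \<comment> \<open>The representative of \<open>k - a\<close> in the range from 1 to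
    \<open>M + 1\<close>, so that colour \<open>a\<close> itself comes last.\<close>
  define c where "c = (k - a - 1) mod (int M + 1) + 1"
  have c: "1 \<le> c" "c \<le> int M + 1"
    unfolding c_def using pos_mod_bound[of "int M + 1" "k - a - 1"] by auto
  have kc: "k mod (int M + 1) = (a + c) mod (int M + 1)"
  proof -
    have "(a + c) mod (int M + 1) = (a + 1 + (k - a - 1) mod (int M + 1)) mod (int M + 1)"
      by (simp add: c_def add_ac)
    also have "\<dots> = k mod (int M + 1)" by (simp add: mod_add_right_eq)
    finally show ?thesis by simp
  qed
  then have kc1: "(k + 1) mod (int M + 1) = (a + c + 1) mod (int M + 1)"
    by (metis mod_add_left_eq)
  have Uc: "U i = U j" if "i mod (int M + 1) = j mod (int M + 1)" for i j
    using that by (simp add: U)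
  have X: "bbsX M U V (a + c) = (if d < c then 1 else 0)" if "1 \<le> c" "c \<le> int M + 1" for c
    by (rule bbsX_value) (fact U V_mod V_nonneg V_zero V_pos d that)+
  have Xk: "bbsX M U V k = (if d < c then 1 else 0)"
    using bbsX_cong_mod[where U = U and V = V, OF Uc V_mod kc] X[OF c] by simp
  have Xk1: "bbsX M U V (k + 1) = (if c = int M + 1 then 0 else if d < c + 1 then 1 else 0)"
  proof (cases "c = int M + 1")
    case True
    then have "(k + 1) mod (int M + 1) = (a + 1) mod (int M + 1)"
      using kc1 by (metis add.assoc add.commute mod_add_self2)
    then have "bbsX M U V (k + 1) = bbsX M U V (a + 1)"
      by (rule bbsX_cong_mod[rotated 2]) (fact Uc V_mod)+
    also have "\<dots> = 0" using X[of 1] d by simp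
    finally show ?thesis using True by simp
  next
    case False
    have "bbsX M U V (k + 1) = bbsX M U V (a + (c + 1))"
      using kc1 unfolding add.assoc by (rule bbsX_cong_mod[rotated 2]) (fact Uc V_mod)+
    also have "\<dots> = (if d < c + 1 then 1 else 0)"
      by (rule X) (use c False in linarith)+
    finally show ?thesis using False by simp
  qed
  have e1: "k mod (int M + 1) = a mod (int M + 1) \<longleftrightarrow> c = int M + 1"
  proof -
    have "a mod (int M + 1) = (a + (int M + 1)) mod (int M + 1)" by simp
    then show ?thesis
      unfolding kc using mod_eq_less_imp_eq[of "a + c" "int M + 1" "a + (int M + 1)"] c by auto
  qed
  have e2: "k mod (int M + 1) = (a + d) mod (int M + 1) \<longleftrightarrow> c = d"
    unfolding kc using mod_eq_less_imp_eq[of "a + c" "int M + 1" "a + d"] c d by auto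
  show ?thesis unfolding Xk Xk1 e1 e2 using c d by auto
qed

lemma bbs_carrier_mod:
  "i mod (int M + 1) = j mod (int M + 1) \<Longrightarrow> bbs_carrier M S u b p i = bbs_carrier M S u b p j"
proof (induction p arbitrary: i j)
  case 0
  then show ?case by simp
next
  case (Suc p)
  have U: "bbsU M u n i = bbsU M u n j" if "i mod (int M + 1) = j mod (int M + 1)" for n i j
    using that by (simp add: bbsU_def)
  have "(i + 1) mod (int M + 1) = (j + 1) mod (int M + 1)"
    using Suc.prems by (metis mod_add_left_eq)
  then have "bbsX M (bbsU M u n) (bbs_carrier M S u b p) (i + 1) = bbsX M (bbsU M u n) (bbs_carrier M S u b p) (j + 1)" for n
    by (intro bbsX_cong_mod U Suc.IH)
  moreover have "bbsX M (bbsU M u n) (bbs_carrier M S u b p) i = bbsX M (bbsU M u n) (bbs_carrier M S u b p) j" for n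
    using Suc.prems by (intro bbsX_cong_mod U Suc.IH)
  ultimately show ?case
    using Suc.IH[OF Suc.prems] by (simp add: Let_def)
qed

lemma int_mod_Suc: "int x mod (int M + 1) = int (x mod Suc M)"
  using zmod_int[of x "Suc M"] by (simp add: add.commute)

lemma bbs_next_eqI:
  assumes "\<And>k. bbs_newU M S u n k = (if k mod (int M + 1) = int c mod (int M + 1) then 1 else 0)"
  shows "bbs_next M S u n = c mod Suc M"
proof -
  have "(\<Sum>k\<in>{1..int M}. k * bbs_newU M S u n k) = (\<Sum>k\<in>{1..int M}. if k = int (c mod Suc M) then k else 0)"
    by (rule sum.cong) (auto simp: assms int_mod_Suc)
  also have "\<dots> = int (c mod Suc M)"
  proof -
    have "c mod Suc M \<le> M" using mod_less_divisor[of "Suc M" c] by linarith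
    then show ?thesis by (cases "c mod Suc M = 0") (auto simp: not_less_eq_eq)
  qed
  finally show ?thesis by (simp add: bbs_next_def)
qed

section \<open>Carrier contents in terms of generations\<close>

locale generated_state = generations +
  fixes u :: "int \<Rightarrow> nat"
  assumes Lam_unbounded: "\<exists>g. p < Lam g"
    and u_gen: "Lam a \<le> int p \<Longrightarrow> int p < Lam (Suc a) \<Longrightarrow> u (bbs_base u + int p) = a mod m"
begin

abbreviation V :: "nat \<Rightarrow> int \<Rightarrow> int" where "V \<equiv> bbs_carrier M S u (bbs_base u)"

lemma ex_input_gen: obtains a where "Lam a \<le> int p" "int p < Lam (Suc a)"
proof (rule ex_step_containing[of Lam "int p"])
  show "Lam 0 \<le> int p" by (simp add: Lam_early)
qed (use Lam_unbounded that in blast)+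

lemma ex_output_gen: obtains c where "Om c \<le> int p" "int p < Om (Suc c)"
proof (rule ex_step_containing[of Om "int p"])
  show "Om 0 \<le> int p" by (simp add: Om_def)
  obtain g where "int p < Lam g" using Lam_unbounded by blast
  then show "\<exists>g. int p < Om g" using Lam_le_Om[of g] by (intro exI[of _ g]) simp
qed (use that in blast)

lemma carrier_step:
  assumes V_W: "\<And>g. int p < Lam (g + m) \<Longrightarrow> V p (int g) = W (int p) g"
    and V_nonneg: "\<And>k. 0 \<le> V p k"
    and a: "Lam a \<le> int p" "int p < Lam (Suc a)"
    and c: "Om c \<le> int p" "int p < Om (Suc c)"
  shows "bbsX M (bbsU M u (bbs_base u + int p)) (V p) k
           - bbsX M (bbsU M u (bbs_base u + int p)) (V p) (k + 1)
         = (if k mod (int M + 1) = int a mod (int M + 1) then 1 else 0)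
           - (if k mod (int M + 1) = int c mod (int M + 1) then 1 else 0)" (is ?diff)
    and "k mod (int M + 1) = int c mod (int M + 1) \<Longrightarrow>
           0 < V p k \<or> k mod (int M + 1) = int a mod (int M + 1)" (is "?P \<Longrightarrow> ?Q")
proof -
  have ca: "c \<le> a"
  proof (rule ccontr)
    assume "\<not> c \<le> a"
    then have "Om (Suc a) \<le> Om c" by (intro Om_mono) simp
    then show False using Lam_le_Om[of "Suc a"] a c by linarith
  qed
  have am: "m < a"
  proof (rule ccontr)
    assume "\<not> m < a"
    then have "Lam (Suc a) = 0" by (intro Lam_early) simp
    then show False using a by simp
  qed
  have ac: "a < c + m"
  proof (rule ccontr)
    assume "\<not> a < c + m"
    then have "Lam (c + m) \<le> Lam a" by (intro Lam_mono) simp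
    then show False using Om_Suc_le[of c] a c by linarith
  qed
  \<comment> \<open>The colour \<open>a + d\<close> is that of \<open>c + m\<close>, hence that of
    \<open>c\<close>. The extreme value \<open>M + 1\<close> is the case \<open>c = a\<close>, in
    which the box keeps its content.\<close>
  define d where "d = int (c + m - a)"
  have d: "1 \<le> d" "d \<le> int M + 1" using ca ac by (auto simp: d_def)
  \<comment> \<open>For \<open>j\<close> at least 1, generation \<open>a + j\<close> has not begun
    to be read, so \<open>a + j - m\<close> is the latest generation of this colour that the carrier
    can hold.\<close>
  have Va: "V p (int a + int (j)) = W (int p) (a + j - m)" if "1 \<le> j" for j
  proof -
    have eq: "int a + int j = int (a + j - m) + int M + 1" using am that by (simp add: of_nat_diff)
    have "V p (int a + int j) = V p (int (a + j - m))"
      by (rule bbs_carrier_mod) (use eq in \<open>metis add.assoc mod_add_self2\<close>)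
    also have "\<dots> = W (int p) (a + j - m)"
    proof (rule V_W)
      have "Lam (Suc a) \<le> Lam (a + j - m + m)" using am that by (intro Lam_mono) auto
      then show "int p < Lam (a + j - m + m)" using a by linarith
    qed
    finally show ?thesis .
  qed
  \<comment> \<open>Generations older than \<open>c\<close> have been read completely, and their
    output ended before promotion could set in, so nothing of them is left.\<close>
  have W_zero: "W (int p) x = 0" if "x < c" "a < x + m" for x
  proof -
    have 1: "Om (Suc x) \<le> Om c" "Lam (Suc x) \<le> Lam a" "Lam (Suc a) \<le> Lam (x + m)"
      using that ca by (auto intro!: Om_mono Lam_mono)
    then have "Out x = D x" using a c by (intro Out_eq_D) linarith
    moreover have "clip (int p) Om x = Out x"
      using 1 c Om_Suc[of x] Out_nonneg[of x] by (simp add: clip_def)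
    ultimately show ?thesis using W_below[of x "int p"] 1 a by simp
  qed
  have W_pos: "0 < W (int p) c" if "c < a"
  proof -
    have "Lam (Suc c) \<le> Lam a" using that by (intro Lam_mono) auto
    then have "W (int p) c = D c - (int p - Om c)"
      using W_below[of c "int p"] a c by (simp add: clip_def)
    then show ?thesis using c Om_Suc[of c] Out_le_D[of c] by linarith
  qed
  have am_mod: "(int a + d) mod (int M + 1) = int c mod (int M + 1)"
  proof -
    have "int a + d = int c + (int M + 1)" using ca ac by (simp add: d_def of_nat_diff)
    then show ?thesis by simp
  qed
  have V_zero: "V p (int a + j) = 0" if "1 \<le> j" "j < d" for j
  proof -
    define i where "i = nat j"
    have i: "1 \<le> i" "j = int i" using that by (auto simp: i_def)
    have "W (int p) (a + i - m) = 0"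
      using that i am ac by (intro W_zero) (auto simp: d_def)
    then show ?thesis using Va[of i] i by simp
  qed
  have V_pos: "d = int M + 1 \<or> 0 < V p (int a + d)"
  proof (cases "c < a")
    case True
    have "V p (int a + d) = W (int p) c"
      using Va[of "c + m - a"] ac ca by (simp add: d_def)
    then show ?thesis using W_pos True by simp
  next
    case False
    then show ?thesis using ca by (simp add: d_def)
  qed
  have U: "bbsU M u (bbs_base u + int p) k = (if k mod (int M + 1) = int a mod (int M + 1) then 1 else 0)" for k
    using u_gen[OF a] by (auto simp: bbsU_def int_mod_Suc)
  show ?diff
    using bbsX_diff[where a = "int a" and d = d and U = "bbsU M u (bbs_base u + int p)" and V = "V p" and k = k,
        OF U bbs_carrier_mod V_nonneg V_zero V_pos d]
    unfolding am_mod by blast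
  show ?Q if ?P
  proof (cases "d = int M + 1")
    case True
    then have "c = a" using ca ac by (auto simp: d_def)
    then show ?thesis using that by simp
  next
    case False
    then have "0 < V p (int a + d)" using V_pos by blast
    moreover have "V p k = V p (int a + d)"
      by (rule bbs_carrier_mod) (simp add: am_mod that)
    ultimately show ?thesis by simp
  qed
qed

text \<open>The guard says that no box read so far belongs to generation \<open>g + m\<close> or
  later, so the generations up to \<open>g\<close> account for every item of their colour.
  Nonnegativity is carried along because the exchange rule \<open>bbsX_diff\<close> presupposes
  it.\<close>

lemma carrier_content:
  "(\<forall>g. int p < Lam (g + m) \<longrightarrow> V p (int g) = W (int p) g) \<and> (\<forall>k. 0 \<le> V p k)"
proof (induction p)
  case 0
  have "V 0 (int g) = W 0 g" if "0 < Lam (g + m)" for g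
  proof -
    \<comment> \<open>The guard has to exclude \<open>g = 0\<close>: the carrier starts with
      \<open>S\<close> items of colour 0, which \<open>W\<close> attributes to generation
      \<open>m\<close>.\<close>
    have "\<not> g + m \<le> Suc m" using that Lam_early[of "g + m"] by force
    then have "0 < g" by auto
    then have "g mod m = 0 \<Longrightarrow> m \<le> g" by (auto intro: dvd_imp_le)
    moreover have "int g mod (int M + 1) = 0 \<longleftrightarrow> g mod m = 0"
      by (simp add: int_mod_Suc)
    ultimately show ?thesis by (auto simp: W_0)
  qed
  then show ?case using S_nonneg by auto
next
  case (Suc p)
  obtain a where a: "Lam a \<le> int p" "int p < Lam (Suc a)" by (rule ex_input_gen)
  obtain c where c: "Om c \<le> int p" "int p < Om (Suc c)" by (rule ex_output_gen)
  have V_W: "\<And>g. int p < Lam (g + m) \<Longrightarrow> V p (int g) = W (int p) g"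
    and V_nonneg: "\<And>k. 0 \<le> V p k" using Suc by blast+
  note step = carrier_step[OF V_W V_nonneg a c]
  have V_Suc: "V (Suc p) k = V p k + (if k mod (int M + 1) = int a mod (int M + 1) then 1 else 0)
           - (if k mod (int M + 1) = int c mod (int M + 1) then 1 else 0)" for k
    using step(1)[of k] by (simp add: Let_def)
  have "0 \<le> V (Suc p) k" for k
    using step(2)[of k] V_nonneg[of k] unfolding V_Suc by auto
  moreover have "V (Suc p) (int g) = W (int (Suc p)) g" if "int (Suc p) < Lam (g + m)" for g
  proof -
    have mod_iff: "(int g mod (int M + 1) = int x mod (int M + 1)) = (g mod m = x mod m)" for x
      by (simp add: int_mod_Suc)
    have le: "x \<le> g" if "g mod m = x mod m" "x < g + m" for x
    proof (rule ccontr)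
      assume "\<not> x \<le> g"
      moreover from this have "m dvd x - g"
        using that(1) mod_eq_dvd_iff_nat[of g x m] by simp
      ultimately have "m dvd x - g" "0 < x - g" by simp_all
      then have "m \<le> x - g" by (rule dvd_imp_le)
      then show False using that(2) by simp
    qed
    have "a < g + m"
    proof (rule ccontr)
      assume "\<not> a < g + m"
      then have "Lam (g + m) \<le> Lam a" by (intro Lam_mono) simp
      then show False using a that by simp
    qed
    moreover have "c < g + m"
    proof (rule ccontr)
      assume "\<not> c < g + m"
      then have "Om (g + m) \<le> Om c" by (intro Om_mono) simp
      then show False using c that Lam_le_Om[of "g + m"] by simp
    qed
    ultimately have "W (int p + 1) g = W (int p) g + (if g mod m = a mod m then 1 else 0)
           - (if g mod m = c mod m then 1 else 0)"
      using W_Suc[OF a c, of g] le[of a] le[of c] by auto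
    moreover have "V p (int g) = W (int p) g" using that by (intro V_W) simp
    ultimately show ?thesis unfolding V_Suc mod_iff by (simp add: add.commute)
  qed
  ultimately show ?case by blast
qed

lemma bbs_next_gen:
  assumes c: "Om c \<le> int p" "int p < Om (Suc c)"
  shows "bbs_next M S u (bbs_base u + int p) = c mod m"
proof (rule bbs_next_eqI)
  fix k
  obtain a where a: "Lam a \<le> int p" "int p < Lam (Suc a)" by (rule ex_input_gen)
  have "bbsU M u (bbs_base u + int p) k = (if k mod (int M + 1) = int a mod (int M + 1) then 1 else 0)"
    using u_gen[OF a] by (auto simp: bbsU_def int_mod_Suc)
  then show "bbs_newU M S u (bbs_base u + int p) k
      = (if k mod (int M + 1) = int c mod (int M + 1) then 1 else 0)"
    using carrier_step(1)[OF _ _ a c, of k] carrier_content[of p]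
    by (simp add: bbs_newU_def Let_def)
qed

end

text \<open>Left of the base, \<open>nat\<close> truncates to 0 and the initial carrier is used. It
  holds empty slots only, so an empty box exchanges nothing with it: this is
  \<open>d = M + 1\<close> in \<open>bbsX_diff\<close>.\<close>

lemma bbs_next_left:
  assumes "0 \<le> S" "n < bbs_base u" "u n = 0"
  shows "bbs_next M S u n = 0"
proof -
  define V where "V = bbs_carrier M S u (bbs_base u) 0"
  have U: "bbsU M u n k = (if k mod (int M + 1) = 0 mod (int M + 1) then 1 else 0)" for k
    using assms by (simp add: bbsU_def)
  have V0: "V (0 + j) = 0" if "1 \<le> j" "j < int M + 1" for j
    using that by (simp add: V_def)
  have "bbsX M (bbsU M u n) V k - bbsX M (bbsU M u n) V (k + 1) = 0" for k
    using bbsX_diff[of "bbsU M u n" M 0 V "int M + 1" k] U V0 bbs_carrier_mod[of _ M _ S u "bbs_base u" 0] assms(1)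
    by (auto simp: V_def)
  then have "bbs_next M S u n = 0 mod Suc M"
    using assms(2) by (intro bbs_next_eqI) (simp add: bbs_newU_def Let_def U V_def algebra_simps)
  then show ?thesis by simp
qed

section \<open>The Toda lattice\<close>

text \<open>The infinite gap behind the last block is cut into pieces of length \<open>S + 1\<close>, one for
  each later generation of colour \<open>0\<close>; this keeps all lengths finite.\<close>
definition gen_length :: "nat \<Rightarrow> int \<Rightarrow> nat \<Rightarrow> (nat \<Rightarrow> nat \<Rightarrow> nat) \<Rightarrow> (nat \<Rightarrow> enat) \<Rightarrow> nat \<Rightarrow> int" where
  "gen_length M S N Q E g =
     (if g \<le> Suc M then 0
      else if g mod Suc M = 0 then
        (let n = g div Suc M - 2 in if Suc n < N then int (the_enat (E n)) else S + 1)
      else int (Q (g mod Suc M) (g div Suc M - 1)))"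

lemma enat_nat_update:
  assumes "0 \<le> b" "b \<le> a"
  shows "enat (nat a) - enat (nat b) + enat c = enat (nat (a - b + int c))"
  using assms by (simp add: nat_add_distrib nat_diff_distrib)

lemma etil_infinity: "etil X \<infinity> Y j = \<infinity>"
  by (induction j) simp_all

lemma mult_add_div: "k < c \<Longrightarrow> (c * q + k) div c = q"
  and mult_add_mod: "k < c \<Longrightarrow> (c * q + k) mod c = k" for c k q :: nat
  by simp_all

locale block_data =
  fixes M :: nat and S :: int and N :: nat and Q :: "nat \<Rightarrow> nat \<Rightarrow> nat" and E :: "nat \<Rightarrow> enat"
  assumes S0: "0 \<le> S"
    and N_pos: "0 < N"
    and Q_zero: "N \<le> n \<Longrightarrow> Q k n = 0"
    and E_finite: "Suc n < N \<Longrightarrow> E n \<noteq> \<infinity>"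
    and E_last: "Suc n = N \<Longrightarrow> E n = \<infinity>"
begin

sublocale generations M S "gen_length M S N Q E"
  by unfold_locales (auto simp: gen_length_def Let_def S0)

abbreviation L :: "nat \<Rightarrow> int" where "L \<equiv> gen_length M S N Q E"
abbreviation G :: nat where "G \<equiv> m * Suc N"

lemma L_Q: "1 \<le> k \<Longrightarrow> k \<le> M \<Longrightarrow> L (m * Suc n + k) = int (Q k n)"
  using mult_add_div[of k m "Suc n"] mult_add_mod[of k m "Suc n"]
  unfolding gen_length_def by simp

lemma L_E:
  "L (m * Suc (Suc n)) = (if Suc n < N then int (the_enat (E n)) else S + 1)"
proof -
  have "\<not> m * Suc (Suc n) \<le> Suc M" by simp
  moreover have "m * Suc (Suc n) mod m = 0" "m * Suc (Suc n) div m = Suc (Suc n)"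
    by (metis mod_mult_self1_is_0, metis nonzero_mult_div_cancel_left nat.distinct(1))
  ultimately show ?thesis unfolding gen_length_def Let_def by simp
qed

lemma L_G: "L G = S + 1"
  using L_E[of "N - 1"] N_pos by simp

lemma Lam_block: "j \<le> M \<Longrightarrow> Lam (Suc (m * Suc n + j)) = Lam (Suc (m * Suc n)) + (\<Sum>k\<in>{1..j}. int (Q k n))"
proof (induction j)
  case (Suc j)
  then show ?case using Lam_Suc[of "m * Suc n + Suc j"] L_Q[of "Suc j" n] by simp
qed simp

text \<open>Releasing all items of the last block needs no more room than the infinite gap behind it,
  for which length \<open>S + 1\<close> is enough.\<close>
lemma Out_last:
  assumes "g < G" "G < g + m"
  shows "Out g = D g"
proof -
  obtain h where h: "g = Suc h" using assms by (cases g) auto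
  have "D g + D G = (\<Sum>x\<in>{g, G}. D x)" using assms by simp
  also have "\<dots> \<le> (\<Sum>x\<in>{g..<g + m}. D x)"
    by (rule sum_mono2) (use assms in \<open>auto simp: D_nonneg\<close>)
  also have "\<dots> = R g + S" using sum_D[of h] h by simp
  finally have "D g \<le> R g" using L_le_D[of G] L_G by simp
  then show ?thesis by (simp add: Out_def)
qed

lemma L_beyond:
  assumes "G \<le> g" "g mod m \<noteq> 0"
  shows "L g = 0"
proof -
  have "Suc N \<le> g div m"
    using div_le_mono[OF assms(1), of m] nonzero_mult_div_cancel_left[of m "Suc N"] by simp
  then have "L g = int (Q (g mod m) (g div m - 1))" "N \<le> g div m - 1"
    using assms L_zero[of g] by (auto simp: gen_length_def Q_zero)
  then show ?thesis by (simp add: Q_zero)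
qed

text \<open>The ball generations of the last block are emitted in full, so no ball is promoted past
  \<open>G\<close>. Hence time \<open>t + 1\<close> has no block beyond the first
  \<open>N\<close>.\<close>

lemma D_beyond:
  assumes "G < g" "g mod m \<noteq> 0"
  shows "D g = 0"
  using assms
proof (induction g rule: less_induct)
  case (less g)
  have g: "m < g" "(g - m) mod m \<noteq> 0" using less.prems by (auto simp: le_mod_geq)
  have "g - m \<noteq> G"
  proof
    assume "g - m = G"
    then show False using g(2) mod_mult_self1_is_0[of m "Suc N"] by argo
  qed
  then consider "g - m < G" | "G < g - m" by linarith
  then have "Out (g - m) = D (g - m)"
  proof cases
    case 1
    then show ?thesis using less.prems g by (intro Out_last) linarith+
  next
    case 2
    then have "D (g - m) = 0" using g by (intro less.IH) auto
    then show ?thesis using Out_le_D[of "g - m"] Out_nonneg[of "g - m"] by simp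
  qed
  moreover have "L g = 0" using less.prems by (intro L_beyond) auto
  ultimately show ?case using g by (subst D_rec) simp
qed

lemma Out_beyond: "G < g \<Longrightarrow> g mod m \<noteq> 0 \<Longrightarrow> Out g = 0"
  using Out_le_D[of g] Out_nonneg[of g] by (simp add: D_beyond)

text \<open>Both sides lose the same output at each step, and the balls of block
  \<open>n + 1\<close> that \<open>etil\<close> adds are the input generation \<open>m\<close>
  places later that \<open>R_Suc\<close> adds.\<close>

lemma etil_R:
  assumes X: "\<And>k. 1 \<le> k \<Longrightarrow> k \<le> M \<Longrightarrow> X k = enat (nat (D (m * Suc n + k)))"
    and "j \<le> M"
  shows "etil X (enat (nat (R (m * Suc n + 1)))) (\<lambda>k. enat (Q k (Suc n))) j
         = enat (nat (R (m * Suc n + Suc j)))"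
  using \<open>j \<le> M\<close>
proof (induction j)
  case (Suc j)
  let ?g = "m * Suc n + Suc j"
  have min: "min (X (Suc j)) (enat (nat (R ?g))) = enat (nat (Out ?g))"
    using X[of "Suc j"] Suc.prems D_nonneg[of ?g] R_nonneg[of ?g]
    by (simp only: Out_def) (simp add: min_def)
  have "L (?g + m) = int (Q (Suc j) (Suc n))"
    using L_Q[of "Suc j" "Suc n"] Suc.prems by (simp add: algebra_simps)
  then have "R (m * Suc n + Suc (Suc j)) = R ?g - Out ?g + int (Q (Suc j) (Suc n))"
    using R_Suc[of ?g] by simp
  then show ?case
    using Suc enat_nat_update[of "Out ?g" "R ?g"] Out_nonneg[of ?g] Out_le_R[of ?g]
    by (simp only: etil.simps min)
qed simp

text \<open>The dictionary between lattice and generations. The maxima in the initial values are the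
  effect of generation \<open>m\<close>, whose stock is \<open>S\<close> and whose room is the size
  of block 0. At the last block the lattice has an infinite gap where the generations have finite
  pieces, so \<open>e\<close> is infinite there and nothing is claimed about
  \<open>F\<close>.\<close>

lemma hut_state_eq_aux:
  "n < N \<Longrightarrow> hut_state M S Q E n = (X, e, F) \<Longrightarrow>
    (\<forall>k. 1 \<le> k \<longrightarrow> k \<le> M \<longrightarrow> X k = enat (nat (D (m * Suc n + k)))) \<and>
    e = (if Suc n < N then enat (nat (R (m * Suc n + 1))) else \<infinity>) \<and>
    (Suc n < N \<longrightarrow> F = enat (nat (D (m * Suc (Suc n)))))"
proof (induction n arbitrary: X e F)
  case 0
  let ?s = "int (\<Sum>k\<in>{1..M}. Q k 0)"
  have X: "X = (\<lambda>k. enat (Q k 0))" and e: "e = E 0 + enat (nat (max 0 (?s - S)))"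
    and F: "F = E 0 + enat (nat (max 0 (S - ?s)))"
    using 0 by (auto simp: Let_def)
  have D_m: "D m = S" using D_early[of 0] Out_early[of 0] by (subst D_rec) (simp add: L_zero)
  have R_m: "R m = ?s"
  proof -
    have "Om m = 0" unfolding Om_def by (rule sum.neutral) (simp add: Out_early)
    moreover have "Lam (m + m) = ?s"
      using Lam_block[of M 0] Lam_early[of "Suc m"] by simp
    ultimately show ?thesis by (simp add: R_eq)
  qed
  have L2: "E 0 = enat (nat (L (m * 2)))" "0 \<le> L (m * 2)" if "Suc 0 < N"
    using that L_E[of 0] E_finite[of 0] by (auto simp: numeral_2_eq_2)
  have c1: "X k = enat (nat (D (m * Suc 0 + k)))" if "1 \<le> k" "k \<le> M" for k
    using that D_early[of k] Out_early[of k] L_Q[of k 0] by (subst D_rec) (simp add: X)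
  have c2: "e = (if Suc 0 < N then enat (nat (R (m * Suc 0 + 1))) else \<infinity>)"
    proof (cases "Suc 0 < N")
      case True
      have "R (m + 1) = ?s - min S ?s + L (m * 2)"
        using R_Suc[of m] by (simp add: Out_def D_m R_m mult_2_right)
      then show ?thesis using True L2 by (auto simp: e nat_add_distrib max_def min_def)
    next
      case False
      then show ?thesis using N_pos E_last[of 0] by (simp add: e)
    qed
  have c3: "F = enat (nat (D (m * Suc (Suc 0))))" if "Suc 0 < N"
  proof -
    have "D (m * 2) = L (m * 2) + (S - min S ?s)"
      using D_m R_m by (subst D_rec) (simp add: Out_def mult_2_right)
    then show ?thesis using that L2 by (auto simp: F nat_add_distrib max_def min_def numeral_2_eq_2)
  qed
  show ?case using c1 c2 c3 by blast
next
  case (Suc n)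
  obtain X' e' F' where H': "hut_state M S Q E n = (X', e', F')" by (metis prod_cases3)
  have n: "Suc n < N" "n < N" using Suc.prems by auto
  have X': "X' k = enat (nat (D (m * Suc n + k)))" if "1 \<le> k" "k \<le> M" for k
    using Suc.IH[OF n(2) H'] that by blast
  have e': "e' = enat (nat (R (m * Suc n + 1)))"
    using Suc.IH[OF n(2) H'] n by simp
  have F': "F' = enat (nat (D (m * Suc (Suc n))))"
    using Suc.IH[OF n(2) H'] n by simp
  define Et where "Et = etil X' e' (\<lambda>k. enat (Q k (Suc n)))"
  have Et: "Et j = enat (nat (R (m * Suc n + Suc j)))" if "j \<le> M" for j
    unfolding Et_def e' by (rule etil_R[OF X' that])
  have X: "X = (\<lambda>k. X' k - min (X' k) (Et (k - 1)) + enat (Q k (Suc n)))"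
    and e: "e = Et M - min F' (Et M) + E (Suc n)"
    and F: "F = F' - min F' (Et M) + E (Suc n)"
    using Suc.prems H' by (auto simp: Let_def Et_def)
  have Et_M: "Et M = enat (nat (R (m * Suc (Suc n))))"
    using Et[of M] by (simp add: algebra_simps)
  have min_M: "min F' (Et M) = enat (nat (Out (m * Suc (Suc n))))"
    unfolding F' Et_M Out_def using D_nonneg R_nonneg by (simp add: min_def)
  let ?g = "m * Suc (Suc n)"
  have E: "E (Suc n) = enat (nat (L (?g + m)))" "0 \<le> L (?g + m)" if "Suc (Suc n) < N"
    using that L_E[of "Suc n"] E_finite[of "Suc n"] by (auto simp: add.commute)
  have c1: "X k = enat (nat (D (m * Suc (Suc n) + k)))" if k: "1 \<le> k" "k \<le> M" for k
  proof -
    let ?h = "m * Suc n + k"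
    have "min (X' k) (Et (k - 1)) = enat (nat (Out ?h))"
      using k X'[of k] Et[of "k - 1"] D_nonneg[of ?h] R_nonneg[of ?h]
      by (simp only: Out_def) (simp add: min_def)
    moreover have "D (m * Suc (Suc n) + k) = D ?h - Out ?h + int (Q k (Suc n))"
      using k L_Q[of k "Suc n"] by (subst D_rec) (simp add: algebra_simps)
    ultimately show ?thesis
      using X'[OF k] enat_nat_update[of "Out ?h" "D ?h" "Q k (Suc n)"] Out_nonneg[of ?h] Out_le_D[of ?h]
      by (simp only: X)
  qed
  have c2: "e = (if Suc (Suc n) < N then enat (nat (R (m * Suc (Suc n) + 1))) else \<infinity>)"
    proof (cases "Suc (Suc n) < N")
      case True
      have "R (?g + 1) = R ?g - Out ?g + L (?g + m)" using R_Suc[of ?g] by simp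
      moreover have "e = enat (nat (R ?g)) - enat (nat (Out ?g)) + enat (nat (L (?g + m)))"
        unfolding e min_M unfolding Et_M E(1)[OF True] ..
      ultimately show ?thesis
        using enat_nat_update[of "Out ?g" "R ?g" "nat (L (?g + m))"] Out_nonneg[of ?g] Out_le_R[of ?g]
          E(2)[OF True] True by simp
    next
      case False
      then have "E (Suc n) = \<infinity>" using n E_last[of "Suc n"] by simp
      then show ?thesis using False by (simp add: e)
    qed
  have c3: "F = enat (nat (D (m * Suc (Suc (Suc n)))))" if "Suc (Suc n) < N"
  proof -
    have "D (m * Suc (Suc (Suc n))) = D ?g - Out ?g + L (?g + m)"
      by (subst D_rec) (simp add: algebra_simps)
    moreover have "F = enat (nat (D ?g)) - enat (nat (Out ?g)) + enat (nat (L (?g + m)))"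
      unfolding F min_M unfolding F' E(1)[OF that] ..
    ultimately show ?thesis
      using enat_nat_update[of "Out ?g" "D ?g" "nat (L (?g + m))"] Out_nonneg[of ?g] Out_le_D[of ?g]
        E(2)[OF that] by simp
  qed
  show ?case using c1 c2 c3 by blast
qed

lemma hut_state_eq:
  assumes "n < N" "hut_state M S Q E n = (X, e, F)"
  shows "\<And>k. 1 \<le> k \<Longrightarrow> k \<le> M \<Longrightarrow> X k = enat (nat (D (m * Suc n + k)))"
    and "e = (if Suc n < N then enat (nat (R (m * Suc n + 1))) else \<infinity>)"
    and "Suc n < N \<Longrightarrow> F = enat (nat (D (m * Suc (Suc n))))"
  using hut_state_eq_aux[OF assms] by blast+

lemma hut_Q_eq:
  assumes "n < N" "1 \<le> k" "k \<le> M"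
  shows "hut_Q M S Q E k n = enat (nat (Out (m * Suc n + k)))"
proof -
  obtain X e F where H: "hut_state M S Q E n = (X, e, F)" by (metis prod_cases3)
  let ?g = "m * Suc n + k"
  have X: "X k = enat (nat (D (m * Suc n + k)))" if "1 \<le> k" "k \<le> M" for k
    using hut_state_eq(1)[OF assms(1) H that] .
  have hut: "hut_Q M S Q E k n = min (X k) (etil X e (\<lambda>k. enat (Q k (Suc n))) (k - 1))"
    by (simp add: hut_Q_def H)
  show ?thesis
  proof (cases "Suc n < N")
    case True
    have "e = enat (nat (R (m * Suc n + 1)))" using hut_state_eq(2)[OF assms(1) H] True by simp
    then have "etil X e (\<lambda>k. enat (Q k (Suc n))) (k - 1) = enat (nat (R (m * Suc n + Suc (k - 1))))"
      using etil_R[OF X, of "k - 1"] assms by simp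
    then show ?thesis
      using assms D_nonneg[of ?g] R_nonneg[of ?g] by (simp only: hut X Out_def) (simp add: min_def)
  next
    case False
    then have "e = \<infinity>" using hut_state_eq(2)[OF assms(1) H] by simp
    \<comment> \<open>Infinite room makes the lattice release the whole stock; the finite pieces of
      the last gap have the same effect.\<close>
    moreover have "Out ?g = D ?g"
    proof (rule Out_last)
      have "n = N - 1" using False assms by simp
      then have "m * Suc (Suc n) = G" using N_pos by simp
      then show "?g < G" "G < ?g + m" using assms by auto
    qed
    ultimately show ?thesis using X[of k] assms by (simp add: hut etil_infinity)
  qed
qed

lemma hut_E_eq:
  assumes "Suc n < N"
  shows "hut_E M S Q E n = enat (nat (Out (m * Suc (Suc n))))"
proof -
  obtain X e F where H: "hut_state M S Q E n = (X, e, F)" by (metis prod_cases3)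
  let ?g = "m * Suc (Suc n)"
  have n: "n < N" using assms by simp
  have X: "X k = enat (nat (D (m * Suc n + k)))" if "1 \<le> k" "k \<le> M" for k
    using hut_state_eq(1)[OF n H that] .
  have "e = enat (nat (R (m * Suc n + 1)))" using hut_state_eq(2)[OF n H] assms by simp
  then have "etil X e (\<lambda>k. enat (Q k (Suc n))) M = enat (nat (R ?g))"
    using etil_R[OF X, of M] by (simp add: algebra_simps)
  moreover have "F = enat (nat (D ?g))" using hut_state_eq(3)[OF n H] assms by simp
  ultimately show ?thesis
    using D_nonneg[of ?g] R_nonneg[of ?g] by (simp add: hut_E_def H Out_def min_def)
qed

end

section \<open>Block decompositions\<close>

lemma is_blocks_less:
  assumes "is_blocks v bs" "i < j" "j < length bs"
  shows "snd (bs ! i) < fst (bs ! j)"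
  using assms(2,3)
proof (induction j)
  case (Suc j)
  have step: "snd (bs ! j) < fst (bs ! Suc j)" and le: "fst (bs ! j) \<le> snd (bs ! j)"
    using assms(1) Suc.prems unfolding is_blocks_def by auto
  show ?case
  proof (cases "i = j")
    case True
    then show ?thesis using step by simp
  next
    case False
    then have "snd (bs ! i) < fst (bs ! j)" using Suc by simp
    then show ?thesis using step le by simp
  qed
qed simp

lemma is_blocks_nonzero:
  assumes "is_blocks v bs"
  shows "v n \<noteq> 0 \<longleftrightarrow> (\<exists>i<length bs. fst (bs ! i) \<le> n \<and> n \<le> snd (bs ! i))"
proof -
  have "n \<in> {n. v n \<noteq> 0} \<longleftrightarrow> n \<in> (\<Union>i<length bs. {fst (bs ! i)..snd (bs ! i)})"
    using assms unfolding is_blocks_def by simp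
  then show ?thesis by auto
qed

lemma is_blocks_le:
  assumes "is_blocks v bs" "i < length bs"
  shows "fst (bs ! i) \<le> snd (bs ! i)"
  using assms unfolding is_blocks_def by blast

lemma is_blocks_step:
  assumes "is_blocks v bs" "i < length bs" "fst (bs ! i) \<le> n" "n < snd (bs ! i)"
  shows "v n \<le> v (n + 1)"
  using assms unfolding is_blocks_def by blast

lemma is_blocks_descent:
  assumes "is_blocks v bs" "Suc i < length bs" "snd (bs ! i) + 1 = fst (bs ! Suc i)"
  shows "v (fst (bs ! Suc i)) < v (snd (bs ! i))"
  using assms unfolding is_blocks_def by blast

text \<open>The left ends depend on \<open>v\<close> alone: they are the nonempty boxes that do not
  continue a weakly increasing run. Together with the analogous right ends this makes the
  decomposition unique.\<close>

lemma is_blocks_fst: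
  assumes "is_blocks v bs"
  shows "set (map fst bs) = {n. v n \<noteq> 0 \<and> \<not> (v (n - 1) \<noteq> 0 \<and> v (n - 1) \<le> v n)}"
proof (intro equalityI subsetI)
  note le = is_blocks_le[OF assms] and less = is_blocks_less[OF assms]
  fix n assume "n \<in> set (map fst bs)"
  then obtain i where i: "i < length bs" "n = fst (bs ! i)" by (auto simp: in_set_conv_nth)
  then have "v n \<noteq> 0" using is_blocks_nonzero[OF assms] le by blast
  moreover have False if nz: "v (n - 1) \<noteq> 0" and mono: "v (n - 1) \<le> v n"
  proof -
    obtain j where j: "j < length bs" "fst (bs ! j) \<le> n - 1" "n - 1 \<le> snd (bs ! j)"
      using is_blocks_nonzero[OF assms] nz by blast
    have "j < i"
    proof (rule ccontr)
      assume "\<not> j < i"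
      then show False using i j le[of i] less[of i j] by (cases "i = j") auto
    qed
    then have "Suc j < length bs" "fst (bs ! Suc j) \<le> n"
      using i less[of "Suc j" i] le[of "Suc j"] by (cases "Suc j = i"; force)+
    moreover have "snd (bs ! j) < fst (bs ! Suc j)" using calculation(1) less by blast
    ultimately have "snd (bs ! j) + 1 = fst (bs ! Suc j)" "fst (bs ! Suc j) = n" "snd (bs ! j) = n - 1"
      using j by auto
    then show False using is_blocks_descent[OF assms, of j] \<open>Suc j < length bs\<close> mono by simp
  qed
  ultimately show "n \<in> {n. v n \<noteq> 0 \<and> \<not> (v (n - 1) \<noteq> 0 \<and> v (n - 1) \<le> v n)}" by blast
next
  fix n assume n: "n \<in> {n. v n \<noteq> 0 \<and> \<not> (v (n - 1) \<noteq> 0 \<and> v (n - 1) \<le> v n)}"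
  then obtain i where i: "i < length bs" "fst (bs ! i) \<le> n" "n \<le> snd (bs ! i)"
    using is_blocks_nonzero[OF assms] by blast
  have "n = fst (bs ! i)"
  proof (rule ccontr)
    assume "n \<noteq> fst (bs ! i)"
    then have n1: "fst (bs ! i) \<le> n - 1" "n - 1 < snd (bs ! i)" "n - 1 \<le> snd (bs ! i)" using i by auto
    then have "v (n - 1) \<noteq> 0" using is_blocks_nonzero[OF assms] i(1) by blast
    moreover have "v (n - 1) \<le> v n"
      using is_blocks_step[OF assms i(1) n1(1,2)] by simp
    ultimately have "v (n - 1) \<noteq> 0" "v (n - 1) \<le> v n" by blast+
    then show False using n by blast
  qed
  then show "n \<in> set (map fst bs)" using i by simp
qed

lemma is_blocks_snd:
  assumes "is_blocks v bs"
  shows "set (map snd bs) = {n. v n \<noteq> 0 \<and> \<not> (v (n + 1) \<noteq> 0 \<and> v n \<le> v (n + 1))}"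
proof (intro equalityI subsetI)
  note le = is_blocks_le[OF assms] and less = is_blocks_less[OF assms]
  fix n assume "n \<in> set (map snd bs)"
  then obtain i where i: "i < length bs" "n = snd (bs ! i)" by (auto simp: in_set_conv_nth)
  then have "v n \<noteq> 0" using is_blocks_nonzero[OF assms] le by blast
  moreover have False if nz: "v (n + 1) \<noteq> 0" and mono: "v n \<le> v (n + 1)"
  proof -
    obtain j where j: "j < length bs" "fst (bs ! j) \<le> n + 1" "n + 1 \<le> snd (bs ! j)"
      using is_blocks_nonzero[OF assms] nz by blast
    have "i < j"
    proof (rule ccontr)
      assume "\<not> i < j"
      then show False using i j le[of i] less[of j i] by (cases "i = j") auto
    qed
    then have "Suc i < length bs" "fst (bs ! Suc i) \<le> n + 1"
      using j less[of "Suc i" j] le[of "Suc i"] by (cases "Suc i = j"; force)+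
    moreover have "snd (bs ! i) < fst (bs ! Suc i)" using calculation(1) less by blast
    ultimately have "snd (bs ! i) + 1 = fst (bs ! Suc i)" "fst (bs ! Suc i) = n + 1"
      using i by auto
    then show False using is_blocks_descent[OF assms, of i] \<open>Suc i < length bs\<close> mono i by simp
  qed
  ultimately show "n \<in> {n. v n \<noteq> 0 \<and> \<not> (v (n + 1) \<noteq> 0 \<and> v n \<le> v (n + 1))}" by blast
next
  fix n assume n: "n \<in> {n. v n \<noteq> 0 \<and> \<not> (v (n + 1) \<noteq> 0 \<and> v n \<le> v (n + 1))}"
  then obtain i where i: "i < length bs" "fst (bs ! i) \<le> n" "n \<le> snd (bs ! i)"
    using is_blocks_nonzero[OF assms] by blast
  have "n = snd (bs ! i)"
  proof (rule ccontr)
    assume "n \<noteq> snd (bs ! i)"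
    then have "n < snd (bs ! i)" "fst (bs ! i) \<le> n + 1" "n + 1 \<le> snd (bs ! i)" using i by auto
    then have "v (n + 1) \<noteq> 0" "v n \<le> v (n + 1)"
      using is_blocks_nonzero[OF assms] is_blocks_step[OF assms, of i n] i by blast+
    then show False using n by blast
  qed
  then show "n \<in> set (map snd bs)" using i by simp
qed

lemma is_blocks_sorted:
  assumes "is_blocks v bs"
  shows "sorted_wrt (<) (map fst bs)" "sorted_wrt (<) (map snd bs)"
proof -
  note le = is_blocks_le[OF assms] and less = is_blocks_less[OF assms]
  show "sorted_wrt (<) (map fst bs)"
    unfolding sorted_wrt_iff_nth_less
  proof (intro allI impI)
    fix i j assume "i < j" "j < length (map fst bs)"
    then show "map fst bs ! i < map fst bs ! j" using le[of i] less[of i j] by simp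
  qed
  show "sorted_wrt (<) (map snd bs)"
    unfolding sorted_wrt_iff_nth_less
  proof (intro allI impI)
    fix i j assume "i < j" "j < length (map snd bs)"
    then show "map snd bs ! i < map snd bs ! j" using le[of j] less[of i j] by simp
  qed
qed

lemma is_blocks_unique:
  assumes "is_blocks v bs" "is_blocks v bs'"
  shows "bs = bs'"
proof -
  have "map fst bs = map fst bs'" "map snd bs = map snd bs'"
    by (rule strict_sorted_equal; use is_blocks_sorted is_blocks_fst is_blocks_snd assms in simp)+
  then show ?thesis
    by (metis zip_map_fst_snd)
qed

section \<open>The blocks at time t + 1\<close>

locale block_state = block_data +
  fixes u :: "int \<Rightarrow> nat"
  assumes u_left: "n < bbs_base u \<Longrightarrow> u n = 0"
    and u_gen': "Lam a \<le> int p \<Longrightarrow> int p < Lam (Suc a) \<Longrightarrow> u (bbs_base u + int p) = a mod m"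
    and window_L: "m \<le> h \<Longrightarrow> h + M < G \<Longrightarrow> \<exists>g\<in>{Suc h..h + M}. 0 < L g"
begin

text \<open>Every piece of the last gap is nonempty, so the generations cover all boxes to the right
  of the base.\<close>

lemma Lam_ge: "int i \<le> Lam (Suc (m * Suc (N + i)))"
proof (induction i)
  case 0
  then show ?case by (simp add: Lam_nonneg)
next
  case (Suc i)
  have "Lam (Suc (m * Suc (N + i))) \<le> Lam (m * Suc (Suc (N + i)))" by (intro Lam_mono) simp
  also have "\<dots> < Lam (Suc (m * Suc (Suc (N + i))))"
    using L_E[of "N + i"] S0 by (simp only: Lam_Suc) simp
  finally show ?case using Suc by simp
qed

sublocale generated_state M S "gen_length M S N Q E" u
proof
  fix p
  have "p < Lam (Suc (m * Suc (N + nat (p + 1))))" using Lam_ge[of "nat (p + 1)"] by linarith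
  then show "\<exists>g. p < Lam g" ..
qed (use u_gen' in blast)

abbreviation v :: "int \<Rightarrow> nat" where "v \<equiv> bbs_next M S u"
abbreviation b :: int where "b \<equiv> bbs_base u"
text \<open>Generation \<open>m * Suc i\<close> is the gap in front of block \<open>i\<close>. A
  block extends from the end of this gap to the beginning of the next one, in offsets from
  \<open>b\<close>.\<close>

definition start :: "nat \<Rightarrow> int" where "start i = Om (Suc (m * Suc i))"
definition stop :: "nat \<Rightarrow> int" where "stop i = Om (m * Suc (Suc i))"

lemma v_left: "n < b \<Longrightarrow> v n = 0"
  using bbs_next_left[OF S0] u_left by blast

lemma window: "m \<le> h \<Longrightarrow> h + M < G \<Longrightarrow> \<exists>g\<in>{Suc h..h + M}. 0 < Out g"
  using window_Out[of G h] window_L L_G S0 by auto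

text \<open>The window that begins after the gap generation \<open>m * Suc i\<close> consists of the
  ball generations of block \<open>i\<close>, so no block vanishes.\<close>

lemma start_less_stop:
  assumes "i < N"
  shows "start i < stop i"
proof -
  let ?h = "m * Suc i"
  have "m * Suc (Suc i) \<le> G" using assms by (intro mult_le_mono2) simp
  then have "?h + M < G" by simp
  moreover have "m \<le> ?h" by simp
  ultimately obtain g where g: "g \<in> {Suc ?h..?h + M}" "0 < Out g" using window by blast
  have "start i \<le> Om g" "Om (Suc g) \<le> stop i"
    unfolding start_def stop_def using g by (auto intro!: Om_mono)
  then show ?thesis using g Om_Suc[of g] by simp
qed

lemma stop_le_start: "i < j \<Longrightarrow> stop i \<le> start j"
proof -
  assume "i < j"
  then have "m * Suc (Suc i) \<le> m * Suc j" by (intro mult_le_mono2) simp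
  then show ?thesis unfolding start_def stop_def by (intro Om_mono) linarith
qed

lemma start_nonneg: "0 \<le> start i"
  by (simp add: start_def Om_nonneg)

lemma block_gen:
  assumes "start i \<le> p" "p < stop i"
  obtains c where "m * Suc i < c" "c < m * Suc (Suc i)" "Om c \<le> p" "p < Om (Suc c)"
    "v (b + p) = c - m * Suc i"
proof -
  have p: "int (nat p) = p" using assms start_nonneg[of i] by simp
  obtain c where c: "Om c \<le> p" "p < Om (Suc c)" using ex_output_gen[of "nat p"] p by metis
  have 1: "m * Suc i < c"
  proof (rule ccontr)
    assume "\<not> m * Suc i < c"
    then have "Om (Suc c) \<le> start i" unfolding start_def by (intro Om_mono) simp
    then show False using c assms by simp
  qed
  have 2: "c < m * Suc (Suc i)"
  proof (rule ccontr)
    assume "\<not> c < m * Suc (Suc i)"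
    then have "stop i \<le> Om c" unfolding stop_def by (intro Om_mono) simp
    then show False using c assms by simp
  qed
  have "c mod m = c - m * Suc i"
    using 1 2 mult_add_mod[of "c - m * Suc i" m "Suc i"] by simp
  then have "v (b + p) = c - m * Suc i"
    using bbs_next_gen[of c "nat p"] c p by simp
  then show ?thesis using that 1 2 c by blast
qed

lemma v_nonzero: "v n \<noteq> 0 \<longleftrightarrow> (\<exists>i<N. b + start i \<le> n \<and> n < b + stop i)"
proof
  assume nz: "v n \<noteq> 0"
  define p where "p = nat (n - b)"
  have n: "n = b + int p" using nz v_left[of n] by (cases "n < b") (auto simp: p_def)
  obtain c where c: "Om c \<le> int p" "int p < Om (Suc c)" by (rule ex_output_gen)
  have c0: "c mod m \<noteq> 0" using nz bbs_next_gen[OF c] n by simp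
  have Out: "Out c \<noteq> 0" using c Om_Suc[of c] by auto
  have "m \<le> c" using Out Out_early[of c] by force
  moreover have "c < G"
    using Out c0 Out_beyond[of c] mod_mult_self1_is_0[of m "Suc N"] by (metis linorder_neqE_nat)
  ultimately have div: "1 \<le> c div m" "c div m < Suc N"
    using div_le_mono[of m c m] less_mult_imp_div_less[of c "Suc N" m]
    by (simp_all only: mult.commute) simp
  define i where "i = c div m - 1"
  have "Suc i = c div m" using div by (simp add: i_def)
  then have i: "i < N" "c = m * Suc i + c mod m" using div mult_div_mod_eq[of m c] by simp_all
  have "c mod m < m" "m * Suc (Suc i) = m * Suc i + m" by simp_all
  then have "Suc (m * Suc i) \<le> c" "Suc c \<le> m * Suc (Suc i)" using i(2) c0 by linarith+
  then have "start i \<le> int p" "int p < stop i"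
    using c Om_mono unfolding start_def stop_def by (meson order_trans less_le_trans)+
  then show "\<exists>i<N. b + start i \<le> n \<and> n < b + stop i" using i n by auto
next
  assume "\<exists>i<N. b + start i \<le> n \<and> n < b + stop i"
  then obtain i where "b + start i \<le> n" "n < b + stop i" by blast
  then have i: "start i \<le> n - b" "n - b < stop i" by linarith+
  obtain c where "m * Suc i < c" "v (b + (n - b)) = c - m * Suc i"
    using block_gen[OF i] by blast
  then show "v n \<noteq> 0" by simp
qed

lemma v_step:
  assumes "start i \<le> p" "p + 1 < stop i"
  shows "v (b + p) \<le> v (b + p + 1)"
proof -
  obtain c where c: "m * Suc i < c" "Om c \<le> p" "p < Om (Suc c)" "v (b + p) = c - m * Suc i"
    using block_gen[of i p] assms by (metis less_add_one less_trans)
  obtain c' where c': "Om c' \<le> p + 1" "p + 1 < Om (Suc c')" "v (b + (p + 1)) = c' - m * Suc i"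
    using block_gen[of i "p + 1"] assms by (metis less_add_one order_trans less_imp_le)
  have "c \<le> c'"
  proof (rule ccontr)
    assume "\<not> c \<le> c'"
    then have "Om (Suc c') \<le> Om c" by (intro Om_mono) simp
    then show False using c c' by simp
  qed
  then show ?thesis using c c' by (simp add: add.assoc)
qed

lemma v_descent:
  assumes "Suc i < N" "stop i = start (Suc i)"
  shows "v (b + stop i) < v (b + stop i - 1)"
proof -
  have "start i \<le> stop i - 1" "stop i - 1 < stop i" using start_less_stop[of i] assms by auto
  then obtain c where c: "m * Suc i < c" "c < m * Suc (Suc i)" "stop i - 1 < Om (Suc c)"
    "v (b + (stop i - 1)) = c - m * Suc i"
    using block_gen by metis
  have "start (Suc i) \<le> stop i" "stop i < stop (Suc i)" using start_less_stop[of "Suc i"] assms by auto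
  then obtain c' where c': "m * Suc (Suc i) < c'" "c' < m * Suc (Suc (Suc i))" "Om c' \<le> stop i"
    "v (b + stop i) = c' - m * Suc (Suc i)"
    using block_gen by metis
  \<comment> \<open>Otherwise a nonempty generation would lie strictly between \<open>c\<close> and
    \<open>c'\<close>, whose boxes are adjacent. The bound is below \<open>c + m\<close>, which
    makes the colour of \<open>c'\<close> strictly smaller than that of \<open>c\<close>.\<close>
  have "c' \<le> c + M"
  proof (rule ccontr)
    assume less: "\<not> c' \<le> c + M"
    have "m * Suc (Suc (Suc i)) \<le> G" using assms by (intro mult_le_mono2) simp
    then have "c + M < G" "m \<le> c" using less c c' by auto
    then obtain g where g: "g \<in> {Suc c..c + M}" "0 < Out g" using window by blast
    then have "Om (Suc c) \<le> Om g" "Om (Suc g) \<le> Om c'" using less by (auto intro!: Om_mono)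
    then show False using c c' g Om_Suc[of g] by linarith
  qed
  then have "c' - m * Suc (Suc i) < c - m * Suc i" using c c' by auto
  moreover have "b + (stop i - 1) = b + stop i - 1" by simp
  ultimately show ?thesis using c c' by metis
qed

definition next_blocks :: "(int \<times> int) list" where
  "next_blocks = map (\<lambda>i. (b + start i, b + stop i - 1)) [0..<N]"

lemma next_blocks_nth: "i < N \<Longrightarrow> next_blocks ! i = (b + start i, b + stop i - 1)"
  by (simp add: next_blocks_def)

lemma length_next_blocks: "length next_blocks = N"
  by (simp add: next_blocks_def)

lemma is_blocks_next: "is_blocks v next_blocks"
  unfolding is_blocks_def length_next_blocks
proof (intro conjI allI impI)
  fix i assume "i < N"
  then show "fst (next_blocks ! i) \<le> snd (next_blocks ! i)"
    using start_less_stop[of i] by (simp add: next_blocks_nth)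
next
  fix i assume "Suc i < N"
  then show "snd (next_blocks ! i) < fst (next_blocks ! Suc i)"
    using stop_le_start[of i "Suc i"] by (simp add: next_blocks_nth)
next
  show "{n. v n \<noteq> 0} = (\<Union>i<N. {fst (next_blocks ! i)..snd (next_blocks ! i)})"
    unfolding v_nonzero by (auto simp: next_blocks_nth)
next
  fix i n assume i: "i < N" and "fst (next_blocks ! i) \<le> n \<and> n < snd (next_blocks ! i)"
  then show "v n \<le> v (n + 1)"
    using v_step[of i "n - b"] by (simp add: next_blocks_nth)
next
  fix i assume "Suc i < N \<and> snd (next_blocks ! i) + 1 = fst (next_blocks ! Suc i)"
  then have "Suc i < N" "stop i = start (Suc i)" by (auto simp: next_blocks_nth)
  then show "v (fst (next_blocks ! Suc i)) < v (snd (next_blocks ! i))"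
    using v_descent[of i] by (simp add: next_blocks_nth)
qed

lemma blkQ_next:
  assumes "n < N" "1 \<le> k" "k \<le> M"
  shows "blkQ v next_blocks k n = nat (Out (m * Suc n + k))"
proof -
  let ?g = "m * Suc n + k"
  have "{j \<in> {b + start n..b + stop n - 1}. v j = k} = {b + Om ?g..b + Om (Suc ?g) - 1}"
  proof (intro equalityI subsetI)
    fix j assume "j \<in> {j \<in> {b + start n..b + stop n - 1}. v j = k}"
    then have j: "start n \<le> j - b" "j - b < stop n" "v (b + (j - b)) = k" by auto
    then obtain c where c: "m * Suc n < c" "Om c \<le> j - b" "j - b < Om (Suc c)" "k = c - m * Suc n"
      using block_gen by metis
    then have "c = ?g" by linarith
    then have "Om ?g \<le> j - b" "j - b < Om (Suc ?g)" using c(2,3) by (simp_all only:)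
    then show "j \<in> {b + Om ?g..b + Om (Suc ?g) - 1}" by simp
  next
    fix j assume j: "j \<in> {b + Om ?g..b + Om (Suc ?g) - 1}"
    have "start n \<le> Om ?g" "Om (Suc ?g) \<le> stop n"
      unfolding start_def stop_def using assms by (auto intro!: Om_mono)
    then have j': "start n \<le> j - b" "j - b < stop n" using j by auto
    then have p: "int (nat (j - b)) = j - b" using start_nonneg[of n] by simp
    have "v (b + int (nat (j - b))) = ?g mod m"
      by (rule bbs_next_gen) (use j in \<open>simp_all only: p atLeastAtMost_iff, linarith+\<close>)
    moreover have "?g mod m = k" by (rule mult_add_mod) (use assms in simp)
    ultimately have "v j = k" by (simp only: p) simp
    then show "j \<in> {j \<in> {b + start n..b + stop n - 1}. v j = k}" using j' by simp
  qed
  then have "blkQ v next_blocks k n = card {b + Om ?g..b + Om (Suc ?g) - 1}"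
    using assms by (simp add: blkQ_def length_next_blocks next_blocks_nth)
  also have "\<dots> = nat (Out ?g)" using Om_Suc[of ?g] by simp
  finally show ?thesis .
qed

lemma blkE_next:
  assumes "Suc n < N"
  shows "blkE next_blocks n = enat (nat (Out (m * Suc (Suc n))))"
proof -
  have "start (Suc n) = stop n + Out (m * Suc (Suc n))"
    by (simp only: start_def stop_def Om_Suc)
  then show ?thesis
    using assms by (simp add: blkE_def length_next_blocks next_blocks_nth)
qed

end

section \<open>From a block decomposition at time t to generations\<close>

lemma finite_interval_Collect: "finite {x \<in> {a..b}. P x}" for a b :: int
  by (rule finite_subset[of _ "{a..b}"]) auto

context
  fixes M :: nat and S :: int and u :: "int \<Rightarrow> nat" and bs :: "(int \<times> int) list"
  assumes S_pos: "S > 0" and state: "bbs_state M u" and blocks: "is_blocks u bs" and bs: "length bs \<ge> 1"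
begin

lemma block_data_blocks: "block_data S (length bs) (blkQ u bs) (blkE bs)"
  using S_pos bs by unfold_locales (auto simp: blkQ_def blkE_def)

interpretation block_data M S "length bs" "blkQ u bs" "blkE bs"
  by (rule block_data_blocks)

lemma u_le: "u n \<le> M"
  using state by (simp add: bbs_state_def)

lemma base_eq: "bbs_base u = fst (bs ! 0)"
proof -
  let ?A = "{n. u n \<noteq> 0}"
  have in_A: "fst (bs ! 0) \<in> ?A"
    using is_blocks_nonzero[OF blocks, of "fst (bs ! 0)"] is_blocks_le[OF blocks, of 0] bs by force
  have "fst (bs ! 0) \<le> n" if "n \<in> ?A" for n
  proof -
    obtain i where i: "i < length bs" "fst (bs ! i) \<le> n"
      using is_blocks_nonzero[OF blocks, of n] \<open>n \<in> ?A\<close> by blast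
    then show ?thesis
      using is_blocks_less[OF blocks, of 0 i] is_blocks_le[OF blocks, of 0] bs by (cases "i = 0") force+
  qed
  then have "Min ?A = fst (bs ! 0)"
    using in_A state by (intro Min_eqI) (auto simp: bbs_state_def)
  then show ?thesis using in_A by (auto simp: bbs_base_def)
qed

lemma block_mono:
  assumes "n < length bs" "fst (bs ! n) \<le> x" "x \<le> y" "y \<le> snd (bs ! n)"
  shows "u x \<le> u y"
  using assms(3,4)
proof (induction y rule: int_ge_induct)
  case (step y)
  then have "u y \<le> u (y + 1)" using is_blocks_step[OF blocks assms(1), of y] assms(2) by simp
  then show ?case using step by simp
qed simp

lemma block_pos:
  assumes "n < length bs" "fst (bs ! n) \<le> x" "x \<le> snd (bs ! n)"
  shows "0 < u x"
  using is_blocks_nonzero[OF blocks, of x] assms by blast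

lemma sum_blkQ:
  assumes "n < length bs"
  shows "(\<Sum>k\<in>{1..j}. int (blkQ u bs k n)) = int (card {x \<in> {fst (bs ! n)..snd (bs ! n)}. u x \<le> j})"
proof (induction j)
  case 0
  have "{x \<in> {fst (bs ! n)..snd (bs ! n)}. u x \<le> 0} = {}"
    using block_pos[OF assms] by force
  then show ?case by (metis atLeastatMost_empty card.empty int_ops(1) less_one sum.empty)
next
  case (Suc j)
  have "{x \<in> {fst (bs ! n)..snd (bs ! n)}. u x \<le> Suc j}
      = {x \<in> {fst (bs ! n)..snd (bs ! n)}. u x \<le> j} \<union> {x \<in> {fst (bs ! n)..snd (bs ! n)}. u x = Suc j}"
    by auto
  then have "card {x \<in> {fst (bs ! n)..snd (bs ! n)}. u x \<le> Suc j}
      = card {x \<in> {fst (bs ! n)..snd (bs ! n)}. u x \<le> j} + card {x \<in> {fst (bs ! n)..snd (bs ! n)}. u x = Suc j}"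
    by (simp only:) (rule card_Un_disjoint[OF finite_interval_Collect finite_interval_Collect], force)
  then show ?case using Suc assms by (simp add: blkQ_def)
qed

text \<open>A block is weakly increasing, so its balls of index at most \<open>j\<close> form an
  initial segment, and their number locates its end.\<close>

lemma card_le_iff:
  assumes "n < length bs" "fst (bs ! n) \<le> x" "x \<le> snd (bs ! n)"
  shows "u x \<le> j \<longleftrightarrow> x < fst (bs ! n) + int (card {y \<in> {fst (bs ! n)..snd (bs ! n)}. u y \<le> j})"
proof
  assume "u x \<le> j"
  then have "{fst (bs ! n)..x} \<subseteq> {y \<in> {fst (bs ! n)..snd (bs ! n)}. u y \<le> j}"
    using block_mono[OF assms(1) _ _ assms(3)] assms(3) by force
  then have "card {fst (bs ! n)..x} \<le> card {y \<in> {fst (bs ! n)..snd (bs ! n)}. u y \<le> j}"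
    by (intro card_mono finite_interval_Collect)
  then show "x < fst (bs ! n) + int (card {y \<in> {fst (bs ! n)..snd (bs ! n)}. u y \<le> j})"
    using assms(2) by simp
next
  assume less: "x < fst (bs ! n) + int (card {y \<in> {fst (bs ! n)..snd (bs ! n)}. u y \<le> j})"
  show "u x \<le> j"
  proof (rule ccontr)
    assume "\<not> u x \<le> j"
    then have "y < x" if "y \<le> snd (bs ! n)" "u y \<le> j" for y
      using block_mono[OF assms(1,2), of y] that by (meson le_trans not_le)
    then have "{y \<in> {fst (bs ! n)..snd (bs ! n)}. u y \<le> j} \<subseteq> {fst (bs ! n)..x - 1}" by auto
    then have "card {y \<in> {fst (bs ! n)..snd (bs ! n)}. u y \<le> j} \<le> card {fst (bs ! n)..x - 1}"
      by (intro card_mono) auto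
    then show False using less assms(2) by simp
  qed
qed

lemma Lam_in_block:
  assumes "n < length bs" "j \<le> M" "Lam (Suc (m * Suc n)) = fst (bs ! n) - bbs_base u"
  shows "Lam (Suc (m * Suc n + j)) = fst (bs ! n) - bbs_base u + int (card {y \<in> {fst (bs ! n)..snd (bs ! n)}. u y \<le> j})"
  using Lam_block[OF assms(2), of n] sum_blkQ[OF assms(1), of j] assms(3) by simp

lemma Lam_stop_aux:
  assumes "n < length bs" "Lam (Suc (m * Suc n)) = fst (bs ! n) - bbs_base u"
  shows "Lam (m * Suc (Suc n)) = snd (bs ! n) + 1 - bbs_base u"
proof -
  have "{y \<in> {fst (bs ! n)..snd (bs ! n)}. u y \<le> M} = {fst (bs ! n)..snd (bs ! n)}" by (auto simp: u_le)
  moreover have "m * Suc (Suc n) = Suc (m * Suc n + M)" by simp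
  ultimately have "Lam (m * Suc (Suc n)) = fst (bs ! n) - bbs_base u + int (card {fst (bs ! n)..snd (bs ! n)})"
    using Lam_in_block[OF assms(1) le_refl assms(2)] by (simp only:)
  then show ?thesis using is_blocks_le[OF blocks assms(1)] by simp
qed

lemma Lam_start: "n < length bs \<Longrightarrow> Lam (Suc (m * Suc n)) = fst (bs ! n) - bbs_base u"
proof (induction n)
  case 0
  then show ?case by (simp add: Lam_early base_eq)
next
  case (Suc n)
  then have "Lam (m * Suc (Suc n)) = snd (bs ! n) + 1 - bbs_base u" by (intro Lam_stop_aux) auto
  moreover have "L (m * Suc (Suc n)) = fst (bs ! Suc n) - snd (bs ! n) - 1"
    using L_E[of n] Suc.prems is_blocks_less[OF blocks, of n "Suc n"] by (simp add: blkE_def)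
  ultimately show ?case using Lam_Suc[of "m * Suc (Suc n)"] by (simp only:)
qed

lemma Lam_stop: "n < length bs \<Longrightarrow> Lam (m * Suc (Suc n)) = snd (bs ! n) + 1 - bbs_base u"
  using Lam_stop_aux Lam_start by blast

lemma u_right:
  assumes "snd (bs ! (length bs - 1)) < x"
  shows "u x = 0"
proof (rule ccontr)
  assume "u x \<noteq> 0"
  then obtain i where i: "i < length bs" "x \<le> snd (bs ! i)" using is_blocks_nonzero[OF blocks] by blast
  have "i \<noteq> length bs - 1" using i assms by auto
  then show False
    using i assms is_blocks_less[OF blocks, of i "length bs - 1"]
      is_blocks_le[OF blocks, of "length bs - 1"] by force
qed

lemma u_gap:
  assumes "Suc n < length bs" "snd (bs ! n) < x" "x < fst (bs ! Suc n)"
  shows "u x = 0"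
proof (rule ccontr)
  assume "u x \<noteq> 0"
  then obtain i where i: "i < length bs" "fst (bs ! i) \<le> x" "x \<le> snd (bs ! i)"
    using is_blocks_nonzero[OF blocks] by blast
  have "i \<le> n \<or> Suc n \<le> i" by linarith
  then show False
  proof
    assume "i \<le> n"
    then show False
      using i assms is_blocks_less[OF blocks, of i n] is_blocks_le[OF blocks, of n]
      by (cases "i = n") auto
  next
    assume "Suc n \<le> i"
    then show False
      using i assms is_blocks_less[OF blocks, of "Suc n" i] is_blocks_le[OF blocks, of "Suc n"]
      by (cases "i = Suc n") auto
  qed
qed

lemma u_generation:
  assumes a: "Lam a \<le> int p" "int p < Lam (Suc a)"
  shows "u (bbs_base u + int p) = a mod m"
proof -
  let ?x = "bbs_base u + int p"
  define q k where "q = a div m - 1" and "k = a mod m"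
  have am: "m < a"
  proof (rule ccontr)
    assume "\<not> m < a"
    then have "Lam (Suc a) = 0" by (intro Lam_early) simp
    then show False using a by simp
  qed
  then have "1 \<le> a div m" using div_le_mono[of m a m] by simp
  then have "Suc q = a div m" by (simp add: q_def)
  then have a_eq: "a = m * Suc q + k" using mult_div_mod_eq[of m a] by (simp add: k_def)
  have k: "k \<le> M" using mod_less_divisor[of m a] unfolding k_def by linarith
  have G_eq: "G = m * Suc (Suc (length bs - 1))" by (simp only: Suc_diff_1[OF order.strict_trans2[OF zero_less_one bs]])
  have "u ?x = k"
  proof (cases "G \<le> a")
    case True
    then have "Lam G \<le> int p" using a Lam_mono[of G a] by linarith
    moreover have "Lam G = snd (bs ! (length bs - 1)) + 1 - bbs_base u"
      unfolding G_eq by (rule Lam_stop) (use bs in linarith)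
    ultimately have "u ?x = 0" by (intro u_right) linarith
    \<comment> \<open>From \<open>G\<close> on, only the pieces of the last gap have positive
      length, and their colour is 0.\<close>
    moreover have "k = 0"
    proof (rule ccontr)
      assume "k \<noteq> 0"
      then have "L a = 0" using True L_beyond[of a] by (simp add: k_def)
      then show False using a by (simp add: Lam_Suc)
    qed
    ultimately show ?thesis by simp
  next
    case False
    have q: "q < length bs"
    proof (rule ccontr)
      assume "\<not> q < length bs"
      then have "G \<le> m * Suc q" by (intro mult_le_mono2) simp
      then show False using False a_eq by linarith
    qed
    show ?thesis
    proof (cases k)
      case 0
      have "q \<noteq> 0" using am a_eq 0 by auto
      then obtain n where n: "q = Suc n" by (cases q) auto
      have "Lam a = snd (bs ! n) + 1 - bbs_base u"
        using Lam_stop[of n] q n a_eq 0 by simp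
      moreover have "Lam (Suc a) = fst (bs ! Suc n) - bbs_base u"
        using Lam_start[of q] q n a_eq 0 by simp
      ultimately show ?thesis
        using u_gap[of n ?x] a q n 0 by simp
    next
      case (Suc j)
      let ?C = "\<lambda>j. int (card {y \<in> {fst (bs ! q)..snd (bs ! q)}. u y \<le> j})"
      have L1: "Lam a = fst (bs ! q) - bbs_base u + ?C j"
        using Lam_in_block[OF q _ Lam_start[OF q], of j] k Suc a_eq by simp
      have L2: "Lam (Suc a) = fst (bs ! q) - bbs_base u + ?C k"
        using Lam_in_block[OF q k Lam_start[OF q]] a_eq by simp
      have "a < m * Suc (Suc q)" using a_eq k by simp
      then have "Lam (Suc a) \<le> snd (bs ! q) + 1 - bbs_base u"
        using Lam_mono[of "Suc a" "m * Suc (Suc q)"] Lam_stop[OF q] by simp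
      then have x: "fst (bs ! q) \<le> ?x" "?x \<le> snd (bs ! q)" using a L1 by auto
      have "u ?x \<le> k" "\<not> u ?x \<le> j"
        using card_le_iff[OF q x] a L1 L2 by auto
      then show ?thesis using Suc by simp
    qed
  qed
  then show ?thesis by (simp add: k_def)
qed

lemma L_color:
  assumes "n < length bs" "fst (bs ! n) \<le> x" "x \<le> snd (bs ! n)"
  shows "0 < L (m * Suc n + u x)"
proof -
  have "x \<in> {y \<in> {fst (bs ! n)..snd (bs ! n)}. u y = u x}" using assms by simp
  then have "0 < blkQ u bs (u x) n"
    using assms(1) finite_interval_Collect[of "fst (bs ! n)" "snd (bs ! n)"] unfolding blkQ_def
    by (simp only: if_True card_gt_0_iff) blast
  then show ?thesis using L_Q[of "u x" n] block_pos[OF assms] u_le[of x] by simp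
qed

text \<open>Let \<open>h = m * Suc n + r\<close>. For \<open>r = 0\<close> the window is the whole
  of block \<open>n\<close>. Otherwise it consists of the colours above \<open>r\<close> of block
  \<open>n\<close>, the gap, and the colours below \<open>r\<close> of block \<open>n + 1\<close>.
  If all of these were empty, the two blocks would touch, the left one ending with a colour at most
  \<open>r\<close> and the right one beginning with a colour at least \<open>r\<close>, against the
  descent required at such a boundary.\<close>

lemma L_window:
  assumes "m \<le> h" "h + M < G"
  shows "\<exists>g\<in>{Suc h..h + M}. 0 < L g"
proof (rule ccontr)
  assume "\<not> ?thesis"
  then have none: "\<not> 0 < L g" if "h < g" "g \<le> h + M" for g using that by auto
  define n r where "n = h div m - 1" and "r = h mod m"
  have "1 \<le> h div m" using assms(1) div_le_mono[of m h m] by simp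
  then have "Suc n = h div m" by (simp add: n_def)
  then have h: "h = m * Suc n + r" using mult_div_mod_eq[of m h] by (simp add: r_def)
  have n: "n < length bs"
  proof (rule ccontr)
    assume "\<not> n < length bs"
    then have "G \<le> m * Suc n" by (intro mult_le_mono2) simp
    then show False using h assms(2) by linarith
  qed
  have le: "fst (bs ! n) \<le> snd (bs ! n)" by (rule is_blocks_le[OF blocks n])
  show False
  proof (cases "r = 0")
    case True
    then show False
      using none[of "m * Suc n + u (fst (bs ! n))"] L_color[OF n order_refl le] h
        block_pos[OF n order_refl le] u_le[of "fst (bs ! n)"] by simp
  next
    case False
    have n': "Suc n < length bs"
    proof (rule ccontr)
      assume "\<not> Suc n < length bs"
      then have "G \<le> m * Suc (Suc n)" by (intro mult_le_mono2) simp
      then show False using h False assms(2) by simp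
    qed
    have le': "fst (bs ! Suc n) \<le> snd (bs ! Suc n)" by (rule is_blocks_le[OF blocks n'])
    have r: "r \<le> M" using mod_less_divisor[of m h] unfolding r_def by linarith
    let ?c = "u (snd (bs ! n))" and ?c' = "u (fst (bs ! Suc n))"
    have "\<not> 0 < L (m * Suc (Suc n))" using h False r by (intro none) auto
    then have "snd (bs ! n) + 1 = fst (bs ! Suc n)"
      using L_E[of n] n' is_blocks_less[OF blocks, of n "Suc n"] by (simp add: blkE_def)
    then have "?c' < ?c" by (rule is_blocks_descent[OF blocks n'])
    moreover have "?c \<le> r"
    proof (rule ccontr)
      assume "\<not> ?c \<le> r"
      then have "h < m * Suc n + ?c" "m * Suc n + ?c \<le> h + M"
        using h u_le[of "snd (bs ! n)"] by linarith+
      then show False using none L_color[OF n le order_refl] by blast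
    qed
    moreover have "r \<le> ?c'"
    proof (rule ccontr)
      assume "\<not> r \<le> ?c'"
      moreover have "m * Suc (Suc n) = m * Suc n + M + 1" by simp
      ultimately have "h < m * Suc (Suc n) + ?c'" "m * Suc (Suc n) + ?c' \<le> h + M"
        using h r by linarith+
      then show False using none L_color[OF n' order_refl le'] by blast
    qed
    ultimately show False by simp
  qed
qed

lemma block_state_blocks: "block_state M S (length bs) (blkQ u bs) (blkE bs) u"
proof
  show "u n = 0" if "n < bbs_base u" for n
  proof (rule ccontr)
    assume "u n \<noteq> 0"
    then have "bbs_base u \<le> n"
      using state by (auto simp: bbs_base_def bbs_state_def)
    then show False using that by simp
  qed
qed (use u_generation L_window in auto)

end

theorem theorem6:
  fixes M :: nat and S :: int and u :: "int \<Rightarrow> nat" and bs :: "(int \<times> int) list"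
  assumes "M \<ge> 1" and "S > 0"
    and "bbs_state M u"
    and "is_blocks u bs" and "length bs \<ge> 1"
  shows "(\<exists>bs'. is_blocks (bbs_next M S u) bs') \<and>
         (\<forall>bs'. is_blocks (bbs_next M S u) bs' \<longrightarrow>
            length bs' = length bs \<and>
            (\<forall>k\<in>{1..M}. \<forall>n<length bs.
               enat (blkQ (bbs_next M S u) bs' k n) = hut_Q M S (blkQ u bs) (blkE bs) k n) \<and>
            (\<forall>n. Suc n < length bs \<longrightarrow>
               blkE bs' n = hut_E M S (blkQ u bs) (blkE bs) n))"
proof -
  interpret block_state M S "length bs" "blkQ u bs" "blkE bs" u
    by (rule block_state_blocks) (fact assms)+
  show ?thesis
  proof (intro conjI allI impI)
    show "\<exists>bs'. is_blocks v bs'" using is_blocks_next by blast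
    fix bs' assume "is_blocks v bs'"
    then have bs': "bs' = next_blocks" using is_blocks_next is_blocks_unique by blast
    show "length bs' = length bs" by (simp add: bs' length_next_blocks)
    show "\<forall>k\<in>{1..M}. \<forall>n<length bs. enat (blkQ v bs' k n) = hut_Q M S (blkQ u bs) (blkE bs) k n"
      by (simp add: bs' blkQ_next hut_Q_eq)
    show "blkE bs' n = hut_E M S (blkQ u bs) (blkE bs) n" if "Suc n < length bs" for n
      using that by (simp add: bs' blkE_next hut_E_eq)
  qed
qed

end
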